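(* Let $q\ge 2$ be an integer. A measure $\nu$ on $\mathbb{T}$ is the spectral measure of a branching-type stationary stochastic process on the rooted $q$-homogeneous tree $T_q$ if and only if there exists a positive Radon measure $\mu$ on $\mathbb{T}$ such that $$\nu=P_{1/\sqrt{q}}*\mu .$$
   Context: $\mathbb{N}=\{0,1,2,\dots\}$, $\mathbb{T}=\mathbb{R}/2\pi\mathbb{Z}$. $T_q$ is (the vertex set of) the infinite rooted tree in which every vertex, including the root $e$, has exactly $q$ children. For a rooted tree $T$ with graph distance $d$, a rooted geodesic ray is an infinite geodesic $\xi=(\sigma_n)_{n\in\mathbb{N}}$ with $\sigma_0=e$; the set of these is $\partial T$, and each $\xi$ is identified with $\mathbb{N}$ via $\sigma_n\leftrightarrow n$. Two vertices are comparable if they lie on a common rooted geodesic ray. Random variables are complex-valued and, for mean-zero variables, $\mathrm{Cov}(X,Y)=\mathbb{E}(X\overline{Y})$. A mean-zero square-integrable process $(X_n)_{n\in\mathbb{N}}$ is (weakly) stationary if $\mathrm{Cov}(X_n,X_{n+k})$ does not depend on $n$, for all $n,k\in\mathbb{N}$; its spectral measure is the unique positive Radon measure $\nu$ on $\mathbb{T}$ with $\mathrm{Cov}(X_n,X_{n+k})=\int_{\mathbb{T}}e^{-ik\theta}d\nu(\theta)$ for all $n,k\in\mathbb{N}$. A mean-zero square-integrable process $(X_\sigma)_{\sigma\in T}$ (on some probability space) is a branching-type stationary stochastic process on $T$ if: (i) for every $\xi\in\partial T$, the restriction $(X_\sigma)_{\sigma\in\xi}$ is stationary; (ii) all these restrictions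 have the same spectral measure, which is called the spectral measure of the process; (iii) $\mathrm{Cov}(X_\sigma,X_\tau)=0$ for all non-comparable $\sigma,\tau\in T$. For $r\in(0,1)$ the Poisson kernel is $P_r(e^{i\theta})=\frac{1}{2\pi}\sum_{n\in\mathbb{Z}}r^{|n|}e^{in\theta}=\frac{1}{2\pi}\frac{1-r^2}{|1-re^{i\theta}|^2}$, and for a positive Radon measure $\mu$ on $\mathbb{T}$, $(P_r*\mu)(e^{i\theta})=\int_{\mathbb{T}}P_r(e^{i(\theta-\theta')})\,d\mu(\theta')$. The function $P_r*\mu$ is identified with the measure having density $P_r*\mu$ with respect to $d\theta$. *)

theory Defs
  imports "HOL-Probability.Probability"
begin

(* The torus R/2piZ is realised as the unit circle of the complex plane, a class theta
   being represented by the point exp(i theta) = cis theta. *)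

definition torus :: "complex measure" where
  "torus = restrict_space borel (sphere 0 1)"

(* The measure d theta, of total mass 2 pi. *)
definition torus_lebesgue :: "complex measure" where
  "torus_lebesgue = distr (restrict_space lborel {0..<2 * pi}) torus cis"

(* On a compact metric space, positive Radon measures are the finite Borel measures. *)
definition radon_torus :: "complex measure \<Rightarrow> bool" where
  "radon_torus \<mu> \<longleftrightarrow> sets \<mu> = sets torus \<and> finite_measure \<mu>"

definition poisson_kernel :: "real \<Rightarrow> complex \<Rightarrow> real" where
  "poisson_kernel r z = 1 / (2 * pi) * ((1 - r\<^sup>2) / (cmod (1 - of_real r * z))\<^sup>2)"

(* For w = exp(i theta) and z = exp(i theta'), w / z = exp(i (theta - theta')). *)
definition poisson_conv :: "real \<Rightarrow> complex measure \<Rightarrow> complex \<Rightarrow> real" where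
  "poisson_conv r \<mu> w = (LINT z|\<mu>. poisson_kernel r (w / z))"

definition poisson_conv_measure :: "real \<Rightarrow> complex measure \<Rightarrow> complex measure" where
  "poisson_conv_measure r \<mu> = density torus_lebesgue (\<lambda>w. ennreal (poisson_conv r \<mu> w))"


(* A rooted tree is given by its vertex set V, its symmetric edge relation E and its root e. *)

definition graph_dist :: "('v \<times> 'v) set \<Rightarrow> 'v \<Rightarrow> 'v \<Rightarrow> nat" where
  "graph_dist E x y = (LEAST n. (x, y) \<in> E ^^ n)"

definition rooted_rays :: "'v set \<Rightarrow> ('v \<times> 'v) set \<Rightarrow> 'v \<Rightarrow> (nat \<Rightarrow> 'v) set" where
  "rooted_rays V E e =
     {\<xi>. \<xi> 0 = e \<and> (\<forall>n. \<xi> n \<in> V) \<and> (\<forall>m n. m \<le> n \<longrightarrow> graph_dist E (\<xi> m) (\<xi> n) = n - m)}"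

definition comparable :: "'v set \<Rightarrow> ('v \<times> 'v) set \<Rightarrow> 'v \<Rightarrow> 'v \<Rightarrow> 'v \<Rightarrow> bool" where
  "comparable V E e \<sigma> \<tau> \<longleftrightarrow> (\<exists>\<xi>\<in>rooted_rays V E e. \<sigma> \<in> range \<xi> \<and> \<tau> \<in> range \<xi>)"

(* T_q: a vertex is the word of child indices leading to it from the root []. *)

definition Tq_vertices :: "nat \<Rightarrow> nat list set" where
  "Tq_vertices q = lists {..<q}"

definition Tq_edges :: "nat \<Rightarrow> (nat list \<times> nat list) set" where
  "Tq_edges q = (let D = {(\<sigma>, \<sigma> @ [i]) | \<sigma> i. \<sigma> \<in> Tq_vertices q \<and> i < q} in D \<union> D\<inverse>)"


definition mean_zero_L2_process ::
    "'w measure \<Rightarrow> 'i set \<Rightarrow> ('i \<Rightarrow> 'w \<Rightarrow> complex) \<Rightarrow> bool" where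
  "mean_zero_L2_process M I X \<longleftrightarrow> prob_space M \<and>
     (\<forall>i\<in>I. X i \<in> borel_measurable M \<and> integrable M (\<lambda>\<omega>. (cmod (X i \<omega>))\<^sup>2)
           \<and> (LINT \<omega>|M. X i \<omega>) = 0)"

(* Covariance of mean-zero variables only. *)
definition cov :: "'w measure \<Rightarrow> ('w \<Rightarrow> complex) \<Rightarrow> ('w \<Rightarrow> complex) \<Rightarrow> complex" where
  "cov M X Y = (LINT \<omega>|M. X \<omega> * cnj (Y \<omega>))"

definition stationary_process :: "'w measure \<Rightarrow> (nat \<Rightarrow> 'w \<Rightarrow> complex) \<Rightarrow> bool" where
  "stationary_process M X \<longleftrightarrow> mean_zero_L2_process M UNIV X \<and>
     (\<forall>m n k. cov M (X m) (X (m + k)) = cov M (X n) (X (n + k)))"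

(* cnj z ^ k is exp(-i k theta) at z = exp(i theta). *)
definition has_spectral_measure ::
    "'w measure \<Rightarrow> (nat \<Rightarrow> 'w \<Rightarrow> complex) \<Rightarrow> complex measure \<Rightarrow> bool" where
  "has_spectral_measure M X \<nu> \<longleftrightarrow> radon_torus \<nu> \<and>
     (\<forall>n k. cov M (X n) (X (n + k)) = (LINT z|\<nu>. cnj z ^ k))"

definition branching_stationary ::
    "'w measure \<Rightarrow> 'v set \<Rightarrow> ('v \<times> 'v) set \<Rightarrow> 'v \<Rightarrow> ('v \<Rightarrow> 'w \<Rightarrow> complex) \<Rightarrow> bool" where
  "branching_stationary M V E e X \<longleftrightarrow>
     mean_zero_L2_process M V X \<and>
     (\<forall>\<xi>\<in>rooted_rays V E e. stationary_process M (\<lambda>n. X (\<xi> n))) \<and>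
     (\<exists>\<nu>. \<forall>\<xi>\<in>rooted_rays V E e. has_spectral_measure M (\<lambda>n. X (\<xi> n)) \<nu>) \<and>
     (\<forall>\<sigma>\<in>V. \<forall>\<tau>\<in>V. \<not> comparable V E e \<sigma> \<tau> \<longrightarrow> cov M (X \<sigma>) (X \<tau>) = 0)"

definition branching_spectral_measure ::
    "'w measure \<Rightarrow> 'v set \<Rightarrow> ('v \<times> 'v) set \<Rightarrow> 'v \<Rightarrow> ('v \<Rightarrow> 'w \<Rightarrow> complex)
      \<Rightarrow> complex measure \<Rightarrow> bool" where
  "branching_spectral_measure M V E e X \<nu> \<longleftrightarrow>
     branching_stationary M V E e X \<and>
     (\<forall>\<xi>\<in>rooted_rays V E e. has_spectral_measure M (\<lambda>n. X (\<xi> n)) \<nu>)"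

end

theory Submission
  imports Defs "HOL-Library.Sublist"
begin

text \<open>
  Put \<open>r = 1 / sqrt q\<close> and let \<open>c k\<close> be the \<open>k\<close>-th Fourier coefficient of \<open>\<nu>\<close>. Convolution with the
  Poisson kernel of radius \<open>r\<close> multiplies the \<open>k\<close>-th Fourier coefficient by \<open>r ^ k\<close>, and a finite measure on
  the circle is determined by its Fourier coefficients. So \<open>\<nu>\<close> is a Poisson convolution exactly when the
  numbers \<open>sqrt q ^ k * c k\<close> are the Fourier coefficients of a positive measure.

  If \<open>\<nu>\<close> is the spectral measure of a branching-type process, these numbers are the covariances of a
  stationary sequence: add the variables over the \<open>n\<close>-th level of the tree and divide by \<open>sqrt q ^ n\<close>. A vertex
  has one ancestor on each level closer to the root and is uncorrelated with the rest of that level, so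
  the covariance of two such sums counts pairs (lemma \<open>cov_normalized_level_sum\<close>). Covariances are positive
  definite, and Herglotz's theorem (theorem \<open>Herglotz\<close>, through the positivity of Fejer means and weak
  compactness) supplies the measure.

  Conversely, a process with given \<open>\<mu>\<close> is written down explicitly. The covariance to be realised is the
  product of \<open>\<integral>z. cnj z ^ k \<partial>\<mu>\<close>, the covariance of the powers \<open>z ^ n\<close> of a random point \<open>z\<close> of the circle, and
  of \<open>r ^ k\<close> on comparable vertices (0 on others), the Gram matrix of the normalised indicators of the
  cylinders of ends of the tree. Multiplying independent copies of the two, and a fair sign to centre
  the variables, gives the process (theorem \<open>poisson_conv_imp_branching_spectral_measure\<close>).
\<close>

section \<open>Rays and comparability in the homogeneous tree\<close>

lemma Tq_edge_iff:
  "(\<sigma>, \<tau>) \<in> Tq_edges q \<longleftrightarrow>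
     \<sigma> \<in> Tq_vertices q \<and> \<tau> \<in> Tq_vertices q \<and> (\<exists>i. \<tau> = \<sigma> @ [i] \<or> \<sigma> = \<tau> @ [i])"
  by (auto simp: Tq_edges_def Tq_vertices_def Let_def)

lemma Tq_edges_sym: "(\<sigma>, \<tau>) \<in> Tq_edges q \<Longrightarrow> (\<tau>, \<sigma>) \<in> Tq_edges q"
  by (auto simp: Tq_edge_iff)

text \<open>
  Each edge changes the length of a word by one. This is the lower bound for distances below.
\<close>

lemma length_le_of_Tq_path: "(\<sigma>, \<tau>) \<in> Tq_edges q ^^ n \<Longrightarrow> length \<tau> \<le> length \<sigma> + n"
  by (induction n arbitrary: \<tau>) (fastforce simp: Tq_edge_iff)+

lemma Tq_path_down:
  "\<sigma> @ \<rho> \<in> Tq_vertices q \<Longrightarrow> (\<sigma>, \<sigma> @ \<rho>) \<in> Tq_edges q ^^ length \<rho>"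
proof (induction \<rho> rule: rev_induct)
  case (snoc i \<rho>)
  then have "(\<sigma> @ \<rho>, \<sigma> @ \<rho> @ [i]) \<in> Tq_edges q" "\<sigma> @ \<rho> \<in> Tq_vertices q"
    by (auto simp: Tq_edge_iff Tq_vertices_def)
  with snoc show ?case by auto
qed simp

lemma relpow_sym: "sym R \<Longrightarrow> (x, y) \<in> R ^^ n \<Longrightarrow> (y, x) \<in> R ^^ n"
proof (induction n arbitrary: y)
  case (Suc n)
  then obtain z where "(x, z) \<in> R ^^ n" "(z, y) \<in> R" by auto
  with Suc show ?case by (auto dest: symD intro!: relpow_Suc_I2 simp del: relpow.simps)
qed simp

text \<open>
  The distance is a \<open>LEAST\<close>, which carries information only when some path exists; connectedness of
  the tree makes it the length of an actual path.
\<close>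

lemma Tq_connected:
  assumes "\<sigma> \<in> Tq_vertices q" "\<tau> \<in> Tq_vertices q"
  shows "(\<sigma>, \<tau>) \<in> Tq_edges q ^^ graph_dist (Tq_edges q) \<sigma> \<tau>"
proof -
  have "sym (Tq_edges q)" by (auto intro: symI Tq_edges_sym)
  then have "(\<sigma>, []) \<in> Tq_edges q ^^ length \<sigma>" "([], \<tau>) \<in> Tq_edges q ^^ length \<tau>"
    using Tq_path_down[of "[]" \<sigma> q] Tq_path_down[of "[]" \<tau> q] assms by (auto intro: relpow_sym)
  then have "(\<sigma>, \<tau>) \<in> Tq_edges q ^^ (length \<sigma> + length \<tau>)"
    by (auto simp: relpow_add)
  then show ?thesis unfolding graph_dist_def by (rule LeastI)
qed

lemma graph_dist_append:
  assumes "\<sigma> @ \<rho> \<in> Tq_vertices q"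
  shows "graph_dist (Tq_edges q) \<sigma> (\<sigma> @ \<rho>) = length \<rho>"
  unfolding graph_dist_def
proof (rule Least_equality)
  show "(\<sigma>, \<sigma> @ \<rho>) \<in> Tq_edges q ^^ length \<rho>" by (rule Tq_path_down[OF assms])
  show "length \<rho> \<le> n" if "(\<sigma>, \<sigma> @ \<rho>) \<in> Tq_edges q ^^ n" for n
    using length_le_of_Tq_path[OF that] by simp
qed

text \<open>
  The distance from the root forces the \<open>n\<close>-th vertex of a ray to be a word of length \<open>n\<close>, and
  consecutive vertices are adjacent words of consecutive lengths; so each extends the previous one.
\<close>

lemma ray_take:
  assumes "\<xi> \<in> rooted_rays (Tq_vertices q) (Tq_edges q) []"
  shows "length (\<xi> n) = n" and "m \<le> n \<Longrightarrow> \<xi> m = take m (\<xi> n)"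
proof -
  have V: "\<xi> n \<in> Tq_vertices q" and dist: "m \<le> n \<Longrightarrow> graph_dist (Tq_edges q) (\<xi> m) (\<xi> n) = n - m"
    and root: "\<xi> 0 = []" for m n
    using assms by (auto simp: rooted_rays_def)
  show len: "length (\<xi> n) = n" for n
    using dist[of 0 n] graph_dist_append[of "[]" "\<xi> n" q] V[of n] root by simp
  have step: "\<exists>i. \<xi> (Suc n) = \<xi> n @ [i]" for n
  proof -
    have "(\<xi> n, \<xi> (Suc n)) \<in> Tq_edges q"
      using Tq_connected[OF V[of n] V[of "Suc n"]] dist[of n "Suc n"] by simp
    then obtain i where "\<xi> (Suc n) = \<xi> n @ [i] \<or> \<xi> n = \<xi> (Suc n) @ [i]"
      by (auto simp: Tq_edge_iff)
    then show ?thesis using len[of n] len[of "Suc n"] by (metis length_append_singleton not_less_eq less_Suc_eq)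
  qed
  show "m \<le> n \<Longrightarrow> \<xi> m = take m (\<xi> n)"
  proof (induction n)
    case (Suc n)
    then show ?case
    proof (cases "m = Suc n")
      case False
      then show ?thesis using Suc step[of n] len by (metis le_SucE take_append append_Nil2 diff_is_0_eq take0)
    qed (simp add: len)
  qed (simp add: root)
qed

text \<open>
  Every vertex lies on a ray: append zeros, which are letters because \<open>q > 0\<close>.
\<close>

lemma ray_through:
  assumes "\<tau> \<in> Tq_vertices q" "q > 0"
  obtains \<xi> where "\<xi> \<in> rooted_rays (Tq_vertices q) (Tq_edges q) []"
    and "\<And>m. m \<le> length \<tau> \<Longrightarrow> \<xi> m = take m \<tau>"
proof
  define \<xi> where "\<xi> n = take n (\<tau> @ replicate n 0)" for n
  have V: "\<xi> n \<in> Tq_vertices q" for n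
    using assms unfolding \<xi>_def Tq_vertices_def in_lists_conv_set
    by (auto dest!: in_set_takeD)
  have "graph_dist (Tq_edges q) (\<xi> m) (\<xi> n) = n - m" if "m \<le> n" for m n
  proof -
    have "take m (\<xi> n) = \<xi> m" using that by (simp add: \<xi>_def min_def)
    then have "\<xi> n = \<xi> m @ drop m (\<xi> n)" by (metis append_take_drop_id)
    moreover have "length (\<xi> n) = n" by (simp add: \<xi>_def)
    ultimately show ?thesis using graph_dist_append[of "\<xi> m" "drop m (\<xi> n)" q] V[of n] by simp
  qed
  then show "\<xi> \<in> rooted_rays (Tq_vertices q) (Tq_edges q) []"
    using V by (auto simp: rooted_rays_def) (simp add: \<xi>_def)
  show "\<xi> m = take m \<tau>" if "m \<le> length \<tau>" for m using that by (simp add: \<xi>_def)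
qed

lemma comparable_iff_prefix:
  assumes "\<sigma> \<in> Tq_vertices q" "\<tau> \<in> Tq_vertices q" "q > 0"
  shows "comparable (Tq_vertices q) (Tq_edges q) [] \<sigma> \<tau> \<longleftrightarrow> prefix \<sigma> \<tau> \<or> prefix \<tau> \<sigma>"
proof
  assume "comparable (Tq_vertices q) (Tq_edges q) [] \<sigma> \<tau>"
  then obtain \<xi> m n where \<xi>: "\<xi> \<in> rooted_rays (Tq_vertices q) (Tq_edges q) []" "\<sigma> = \<xi> m" "\<tau> = \<xi> n"
    by (auto simp: comparable_def)
  then show "prefix \<sigma> \<tau> \<or> prefix \<tau> \<sigma>"
    using ray_take(2)[of \<xi> q m n] ray_take(2)[of \<xi> q n m] take_is_prefix by (metis nle_le)
next
  have *: "comparable (Tq_vertices q) (Tq_edges q) [] (take m \<tau>) \<tau>"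
    if V: "\<tau> \<in> Tq_vertices q" and m: "m \<le> length \<tau>" for m \<tau>
  proof -
    obtain \<xi> where "\<xi> \<in> rooted_rays (Tq_vertices q) (Tq_edges q) []" "\<And>m. m \<le> length \<tau> \<Longrightarrow> \<xi> m = take m \<tau>"
      using ray_through[OF V \<open>q > 0\<close>] by blast
    then show ?thesis unfolding comparable_def
      using m by (metis order_refl rangeI take_all)
  qed
  assume "prefix \<sigma> \<tau> \<or> prefix \<tau> \<sigma>"
  then show "comparable (Tq_vertices q) (Tq_edges q) [] \<sigma> \<tau>"
  proof
    assume "prefix \<sigma> \<tau>" then show ?thesis using *[OF assms(2), of "length \<sigma>"] by (auto simp: prefix_def)
  next
    assume "prefix \<tau> \<sigma>"
    then have "comparable (Tq_vertices q) (Tq_edges q) [] \<tau> \<sigma>"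
      using *[OF assms(1), of "length \<tau>"] by (auto simp: prefix_def)
    then show ?thesis by (simp add: comparable_def conj_commute)
  qed
qed


section \<open>Measures on the circle and their Fourier coefficients\<close>

lemma space_torus [simp]: "space torus = sphere 0 1"
  by (simp add: torus_def space_restrict_space)

lemma
  assumes "radon_torus \<mu>"
  shows radon_torus_sets: "sets \<mu> = sets torus"
    and radon_torus_space: "space \<mu> = sphere 0 1"
    and radon_torus_finite: "finite_measure \<mu>"
  using assms sets_eq_imp_space_eq[of \<mu> torus] by (auto simp: radon_torus_def)

lemma continuous_measurable_torus:
  assumes "continuous_on (sphere 0 1) f" "sets \<mu> = sets torus"
  shows "f \<in> borel_measurable \<mu>"
  using borel_measurable_continuous_on_restrict[OF assms(1)] measurable_cong_sets[OF assms(2) refl]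
  by (auto simp: torus_def)

lemma continuous_integrable_torus:
  fixes f :: "complex \<Rightarrow> 'b::{banach, second_countable_topology}"
  assumes f: "continuous_on (sphere 0 1) f" and \<mu>: "radon_torus \<mu>"
  shows "integrable \<mu> f"
proof -
  interpret finite_measure \<mu> using \<mu> by (rule radon_torus_finite)
  have "compact (f ` sphere 0 1)" using f by (intro compact_continuous_image) auto
  then obtain B where "\<forall>x\<in>f ` sphere 0 1. norm x \<le> B" using compact_imp_bounded bounded_iff by metis
  then show ?thesis
    using \<mu> f by (intro integrable_const_bound[where B = B])
      (auto intro!: continuous_measurable_torus simp: radon_torus_sets radon_torus_space)
qed

text \<open>
  The indicator of a closed set is the pointwise limit of continuous functions of the distance to
  that set, and closed sets form a generator of the Borel sets that is stable under intersection.
\<close>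

lemma radon_torus_eqI_continuous:
  assumes \<mu>: "radon_torus \<mu>" and \<nu>: "radon_torus \<nu>"
    and eq: "\<And>f :: complex \<Rightarrow> real. continuous_on UNIV f \<Longrightarrow> integral\<^sup>L \<mu> f = integral\<^sup>L \<nu> f"
  shows "\<mu> = \<nu>"
proof -
  interpret \<mu>: finite_measure \<mu> using \<mu> by (rule radon_torus_finite)
  interpret \<nu>: finite_measure \<nu> using \<nu> by (rule radon_torus_finite)
  have closed_lim: "(\<lambda>n. \<integral>z. max 0 (1 - real n * infdist z C) \<partial>\<kappa>) \<longlonglongrightarrow> measure \<kappa> (C \<inter> sphere 0 1)"
    if C: "closed C" "C \<noteq> {}" and \<kappa>: "radon_torus \<kappa>" for C :: "complex set" and \<kappa>
  proof -
    interpret finite_measure \<kappa> using \<kappa> by (rule radon_torus_finite)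
    have [measurable_cong]: "sets \<kappa> = sets (restrict_space borel (sphere 0 1))" 
      using radon_torus_sets[OF \<kappa>] by (simp add: torus_def)
    have "(\<lambda>n. \<integral>z. max 0 (1 - real n * infdist z C) \<partial>\<kappa>) \<longlonglongrightarrow> (\<integral>z. indicator C z \<partial>\<kappa>)"
    proof (rule integral_dominated_convergence[where w = "\<lambda>_. 1"])
      have "indicat_real C \<in> borel_measurable (restrict_space borel (sphere 0 1))"
        using C by (intro measurable_restrict_space1 borel_measurable_indicator) auto
      then show "indicat_real C \<in> borel_measurable \<kappa>" by measurable
      show "(\<lambda>z. max 0 (1 - real n * infdist z C)) \<in> borel_measurable \<kappa>" for n
        by (intro continuous_measurable_torus continuous_intros radon_torus_sets[OF \<kappa>])
      show "AE z in \<kappa>. (\<lambda>n. max 0 (1 - real n * infdist z C)) \<longlonglongrightarrow> indicator C z"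
      proof (rule AE_I2)
        fix z
        show "(\<lambda>n. max 0 (1 - real n * infdist z C)) \<longlonglongrightarrow> indicator C z"
        proof (cases "z \<in> C")
          case False
          then have pos: "infdist z C > 0"
            using C by (metis in_closed_iff_infdist_zero infdist_nonneg less_le)
          have "\<forall>\<^sub>F n in sequentially. real n * infdist z C \<ge> 1"
          proof -
            obtain N where "1 / infdist z C < real N" using reals_Archimedean2 by blast
            then have "real n * infdist z C \<ge> 1" if "n \<ge> N" for n
              using pos that by (simp add: field_simps)
                 (smt (verit) mult_left_mono of_nat_mono mult.commute)
            then show ?thesis by (auto simp: eventually_sequentially)
          qed
          then have "\<forall>\<^sub>F n in sequentially. max 0 (1 - real n * infdist z C) = indicator C z"
            by eventually_elim (use False in auto)
          then show ?thesis by (rule tendsto_eventually)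
        qed simp
      qed
      show "AE z in \<kappa>. norm (max 0 (1 - real n * infdist z C)) \<le> 1" for n
        by (intro AE_I2) (simp add: infdist_nonneg)
    qed simp
    also have "(\<integral>z. indicator C z \<partial>\<kappa>) = measure \<kappa> (C \<inter> sphere 0 1)"
      using C by (simp add: radon_torus_space[OF \<kappa>])
    finally show ?thesis .
  qed
  have id_meas: "id \<in> \<kappa> \<rightarrow>\<^sub>M borel" if "radon_torus \<kappa>" for \<kappa>
    by (intro continuous_measurable_torus radon_torus_sets[OF that]) auto
  have em: "emeasure (distr \<kappa> borel id) A = emeasure \<kappa> (A \<inter> sphere 0 1)" 
    if "radon_torus \<kappa>" "A \<in> sets borel" for \<kappa> A
    using id_meas that by (simp add: emeasure_distr radon_torus_space)
  have sets_borel: "sets borel = sigma_sets UNIV (Collect (closed :: complex set \<Rightarrow> bool))"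
    by (simp add: borel_eq_closed)
  have borel_eq: "distr \<mu> borel id = distr \<nu> borel id"
  proof (rule measure_eqI_generator_eq[where E = "Collect closed" and \<Omega> = UNIV and A = "\<lambda>_. UNIV"])
    fix C :: "complex set" assume "C \<in> Collect closed"
    then have C: "closed C" by simp
    have "measure \<mu> (C \<inter> sphere 0 1) = measure \<nu> (C \<inter> sphere 0 1)"
    proof (cases "C = {}")
      case False
      have "(\<integral>z. max 0 (1 - real n * infdist z C) \<partial>\<mu>) = (\<integral>z. max 0 (1 - real n * infdist z C) \<partial>\<nu>)" for n
        by (intro eq continuous_intros)
      then show ?thesis
        using closed_lim[OF C False \<mu>] closed_lim[OF C False \<nu>] LIMSEQ_unique by simp
    qed simp
    then show "emeasure (distr \<mu> borel id) C = emeasure (distr \<nu> borel id) C"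
      using C by (simp add: em \<mu> \<nu> \<mu>.emeasure_eq_measure \<nu>.emeasure_eq_measure)
  qed (auto simp: Int_stable_def sets_borel em \<mu> \<mu>.emeasure_eq_measure)
  show ?thesis
  proof (rule measure_eqI)
    fix A assume "A \<in> sets \<mu>"
    then have "A \<in> sets (restrict_space borel (sphere 0 1))" 
      by (simp add: radon_torus_sets[OF \<mu>] torus_def)
    then have A: "A \<in> sets borel" "A \<inter> sphere 0 1 = A"
      by (auto simp: sets_restrict_space)
    then show "emeasure \<mu> A = emeasure \<nu> A"
      using borel_eq em[OF \<mu> A(1)] em[OF \<nu> A(1)] by simp
  qed (simp add: radon_torus_sets \<mu> \<nu>)
qed

text \<open>
  On the circle \<open>cnj z\<close> is the inverse of \<open>z\<close>, so a monomial in both reduces to a single power.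
\<close>

lemma integral_cnj_torus:
  assumes \<mu>: "radon_torus \<mu>"
  shows "(\<integral>z. z ^ i * cnj z ^ j \<partial>\<mu>) =
    (if i \<le> j then \<integral>z. cnj z ^ (j - i) \<partial>\<mu> else cnj (\<integral>z. cnj z ^ (i - j) \<partial>\<mu>))"
proof -
  have one: "z * cnj z = 1" if "z \<in> space \<mu>" for z
    using that by (simp add: radon_torus_space[OF \<mu>] complex_norm_square[symmetric])
  have "(\<integral>z. z ^ i * cnj z ^ j \<partial>\<mu>) = (\<integral>z. cnj z ^ (j - i) \<partial>\<mu>)" if "i \<le> j"
  proof (rule Bochner_Integration.integral_cong)
    fix z assume "z \<in> space \<mu>"
    then show "z ^ i * cnj z ^ j = cnj z ^ (j - i)"
      using one that power_add[of "cnj z" i "j - i"]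
      by (simp add: mult.assoc[symmetric] power_mult_distrib[symmetric])
  qed simp
  moreover have "(\<integral>z. z ^ i * cnj z ^ j \<partial>\<mu>) = cnj (\<integral>z. cnj z ^ (i - j) \<partial>\<mu>)" if "j < i"
    unfolding Bochner_Integration.integral_cnj[symmetric]
  proof (rule Bochner_Integration.integral_cong)
    fix z assume "z \<in> space \<mu>"
    then show "z ^ i * cnj z ^ j = cnj (cnj z ^ (i - j))"
      using one that power_add[of z "i - j" j]
      by (simp add: mult.assoc power_mult_distrib[symmetric])
  qed simp
  ultimately show ?thesis by (auto simp: not_le)
qed

text \<open>
  By Stone-Weierstrass it suffices to compare the integrals of polynomials in the real and imaginary
  part. Such a polynomial is a combination of monomials in \<open>z\<close> and \<open>cnj z\<close>, whose integrals are Fourier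
  coefficients or their conjugates.
\<close>

lemma integral_eq_of_Fourier_eq:
  fixes f :: "complex \<Rightarrow> real"
  assumes \<mu>: "radon_torus \<mu>" and \<nu>: "radon_torus \<nu>"
    and eq: "\<And>k. (\<integral>z. cnj z ^ k \<partial>\<mu>) = (\<integral>z. cnj z ^ k \<partial>\<nu>)"
    and f: "continuous_on UNIV f"
  shows "integral\<^sup>L \<mu> f = integral\<^sup>L \<nu> f"
proof -
  interpret \<mu>: finite_measure \<mu> using \<mu> by (rule radon_torus_finite)
  interpret \<nu>: finite_measure \<nu> using \<nu> by (rule radon_torus_finite)
  \<comment> \<open>\<open>Q g\<close>: both measures integrate \<open>g\<close> times any monomial equally. Multiplication by a real polynomial
    preserves \<open>Q\<close>, and this form of the claim passes through products in the induction.\<close>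
  define Q where "Q g \<longleftrightarrow> continuous_on UNIV g \<and>
      (\<forall>i j. (\<integral>z. g z * (z ^ i * cnj z ^ j) \<partial>\<mu>) = (\<integral>z. g z * (z ^ i * cnj z ^ j) \<partial>\<nu>))" for g :: "complex \<Rightarrow> complex"
  have int: "integrable \<kappa> (\<lambda>z. g z * (z ^ i * cnj z ^ j))" if "continuous_on UNIV g" "radon_torus \<kappa>"
    for g \<kappa> i j
    by (intro continuous_integrable_torus that continuous_intros continuous_on_subset[OF that(1)]) auto
  have Q1: "Q (\<lambda>_. 1)"
    by (simp add: Q_def integral_cnj_torus[OF \<mu>] integral_cnj_torus[OF \<nu>] eq)
  have Qadd: "Q (\<lambda>z. g z + h z)" if "Q g" "Q h" for g h
    using that by (auto simp: Q_def distrib_right int \<mu> \<nu> intro!: continuous_intros)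
  have Qc: "Q (\<lambda>z. c * g z)" if "Q g" for c g
    using that by (auto simp: Q_def mult.assoc intro!: continuous_intros)
  have Qz: "Q (\<lambda>z. z * g z)" if g: "Q g" for g
    unfolding Q_def
  proof (intro conjI allI)
    fix i j
    have "(\<integral>z. g z * (z ^ Suc i * cnj z ^ j) \<partial>\<mu>) = (\<integral>z. g z * (z ^ Suc i * cnj z ^ j) \<partial>\<nu>)"
      using g unfolding Q_def by blast
    then show "(\<integral>z. z * g z * (z ^ i * cnj z ^ j) \<partial>\<mu>) = (\<integral>z. z * g z * (z ^ i * cnj z ^ j) \<partial>\<nu>)"
      by (simp add: mult_ac)
  qed (use g in \<open>auto simp: Q_def intro!: continuous_intros\<close>)
  have Qcnj: "Q (\<lambda>z. cnj z * g z)" if g: "Q g" for g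
    unfolding Q_def
  proof (intro conjI allI)
    fix i j
    have "(\<integral>z. g z * (z ^ i * cnj z ^ Suc j) \<partial>\<mu>) = (\<integral>z. g z * (z ^ i * cnj z ^ Suc j) \<partial>\<nu>)"
      using g unfolding Q_def by blast
    then show "(\<integral>z. cnj z * g z * (z ^ i * cnj z ^ j) \<partial>\<mu>) = (\<integral>z. cnj z * g z * (z ^ i * cnj z ^ j) \<partial>\<nu>)"
      by (simp add: mult_ac)
  qed (use g in \<open>auto simp: Q_def intro!: continuous_intros\<close>)
  have Qpoly: "Q (\<lambda>z. of_real (p z) * g z)" if "real_polynomial_function p" "Q g" for p g
    using that
  proof (induction arbitrary: g)
    case (linear p)
    note Qg = linear.prems
    interpret bounded_linear p by fact
    \<comment> \<open>Every real-linear form on the plane is a combination of \<open>z\<close> and \<open>cnj z\<close>.\<close>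
    define a b where "a = (complex_of_real (p 1) - \<i> * p \<i>) / 2" and "b = (complex_of_real (p 1) + \<i> * p \<i>) / 2"
    have "complex_of_real (p z) = a * z + b * cnj z" for z
    proof -
      have "p z = p (Re z *\<^sub>R 1 + Im z *\<^sub>R \<i>)"
        by (rule arg_cong[where f = p]) (simp add: complex_eq_iff)
      also have "\<dots> = Re z * p 1 + Im z * p \<i>" by (simp only: add scaleR) simp
      finally show ?thesis by (simp add: a_def b_def complex_eq_iff field_simps)
    qed
    then have "(\<lambda>z. of_real (p z) * g z) = (\<lambda>z. a * (z * g z) + b * (cnj z * g z))"
      by (simp add: fun_eq_iff algebra_simps)
    then show ?case using Qg by (simp add: Qadd Qc Qz Qcnj)
  next
    case (add p p')
    then show ?case using Qadd by (simp add: distrib_right)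
  next
    case (mult p p')
    then show ?case by (simp add: mult.assoc)
  qed (simp add: Qc)
  have poly_eq: "integral\<^sup>L \<mu> p = integral\<^sup>L \<nu> p" if "real_polynomial_function p" for p
  proof -
    have *: "\<forall>i j. (\<integral>z. of_real (p z) * 1 * (z ^ i * cnj z ^ j) \<partial>\<mu>) = (\<integral>z. of_real (p z) * 1 * (z ^ i * cnj z ^ j) \<partial>\<nu>)"
      using Qpoly[OF that Q1] unfolding Q_def by blast
    have "complex_of_real (integral\<^sup>L \<mu> p) = of_real (integral\<^sup>L \<nu> p)"
      using *[rule_format, of 0 0] by simp
    then show ?thesis by (simp only: of_real_eq_iff)
  qed
  let ?c = "measure \<mu> (space \<mu>) + measure \<nu> (space \<nu>)"
  have bound: "\<bar>integral\<^sup>L \<mu> f - integral\<^sup>L \<nu> f\<bar> \<le> e * ?c" if "e > 0" for e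
  proof -
    have fS: "continuous_on (sphere 0 1) f" using f continuous_on_subset by blast
    obtain p where p: "real_polynomial_function p" "\<And>z. z \<in> sphere 0 1 \<Longrightarrow> \<bar>f z - p z\<bar> < e"
      using Stone_Weierstrass_real_polynomial_function[OF compact_sphere fS \<open>e > 0\<close>] by metis
    have close: "\<bar>integral\<^sup>L \<kappa> f - integral\<^sup>L \<kappa> p\<bar> \<le> e * measure \<kappa> (space \<kappa>)" if \<kappa>: "radon_torus \<kappa>" for \<kappa>
    proof -
      interpret finite_measure \<kappa> using \<kappa> by (rule radon_torus_finite)
      have i: "integrable \<kappa> f" "integrable \<kappa> p"
        using fS p(1) \<kappa> by (auto intro!: continuous_integrable_torus continuous_on_polymonial_function
            simp: real_polynomial_function_eq)
      have "\<bar>integral\<^sup>L \<kappa> f - integral\<^sup>L \<kappa> p\<bar> = norm (\<integral>z. f z - p z \<partial>\<kappa>)"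
        using i by simp
      also have "\<dots> \<le> (\<integral>z. \<bar>f z - p z\<bar> \<partial>\<kappa>)"
        using integral_norm_bound[of \<kappa> "\<lambda>z. f z - p z"] by simp
      also have "\<dots> \<le> (\<integral>z. e \<partial>\<kappa>)"
        using i p(2) by (intro integral_mono) (auto simp: radon_torus_space[OF \<kappa>] less_imp_le)
      finally show ?thesis by (simp add: mult.commute)
    qed
    show ?thesis
      using close[OF \<mu>] close[OF \<nu>] poly_eq[OF p(1)] by (simp add: distrib_left)
  qed
  show ?thesis
  proof (rule ccontr)
    assume ne: "integral\<^sup>L \<mu> f \<noteq> integral\<^sup>L \<nu> f"
    define d where "d = \<bar>integral\<^sup>L \<mu> f - integral\<^sup>L \<nu> f\<bar>"
    have c: "?c \<ge> 0" by simp
    have "d > 0" using ne by (simp add: d_def)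
    have "d \<le> d / (2 * (?c + 1)) * ?c" using bound[of "d / (2 * (?c + 1))"] \<open>d > 0\<close> c
      unfolding d_def[symmetric] by (simp add: add_nonneg_pos)
    also have "\<dots> \<le> d / 2"
    proof -
      have "?c / (?c + 1) \<le> 1" using c by (subst divide_le_eq_1) linarith
      then have "d / 2 * (?c / (?c + 1)) \<le> d / 2 * 1" using \<open>d > 0\<close> by (intro mult_left_mono) auto
      then show ?thesis by simp
    qed
    finally show False using \<open>d > 0\<close> by simp
  qed
qed

lemma radon_torus_eqI_Fourier:
  assumes \<mu>: "radon_torus \<mu>" and \<nu>: "radon_torus \<nu>"
    and eq: "\<And>k. (\<integral>z. cnj z ^ k \<partial>\<mu>) = (\<integral>z. cnj z ^ k \<partial>\<nu>)"
  shows "\<mu> = \<nu>"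
  using \<mu> \<nu> integral_eq_of_Fourier_eq[OF assms] by (rule radon_torus_eqI_continuous)


section \<open>Lebesgue measure, weak compactness and Herglotz\<close>

lemma cis_measurable_torus: "cis \<in> borel \<rightarrow>\<^sub>M torus"
  unfolding torus_def
  by (rule measurable_restrict_space2) (auto intro!: borel_measurable_continuous_onI continuous_intros)

lemma cis_measurable_interval: "cis \<in> restrict_space lborel {0..<2 * pi} \<rightarrow>\<^sub>M torus"
  by (rule measurable_restrict_space1) (use cis_measurable_torus in simp)

lemma radon_torus_lebesgue: "radon_torus torus_lebesgue"
proof -
  interpret finite_measure "restrict_space lborel {0..<2 * pi}"
    by (rule finite_measureI) (simp add: emeasure_restrict_space space_restrict_space)
  show ?thesis
    unfolding radon_torus_def torus_lebesgue_def
    using finite_measure_distr[OF cis_measurable_interval] by simp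
qed

lemma integral_power_torus_lebesgue:
  "(\<integral>z. cnj z ^ k \<partial>torus_lebesgue) = (if k = 0 then 2 * pi else 0)"
proof -
  have cnj_power: "cnj (cis \<theta>) ^ k = cis (- (real k * \<theta>))" for \<theta>
    unfolding complex_cnj_power[symmetric] Complex.DeMoivre by (simp add: complex_eq_iff)
  have "(\<integral>z. cnj z ^ k \<partial>torus_lebesgue) = (\<integral>\<theta>. cnj (cis \<theta>) ^ k \<partial>restrict_space lborel {0..<2 * pi})"
    unfolding torus_lebesgue_def
    by (intro integral_distr cis_measurable_interval continuous_measurable_torus continuous_intros) simp
  also have "\<dots> = (\<integral>\<theta>. indicator {0..<2 * pi} \<theta> *\<^sub>R cis (- (real k * \<theta>)) \<partial>lborel)"
    by (simp add: integral_restrict_space cnj_power)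
  also have "\<dots> = (\<integral>\<theta>. indicator {0..2 * pi} \<theta> *\<^sub>R cis (- (real k * \<theta>)) \<partial>lborel)"
  proof (rule integral_cong_AE)
    have "(\<lambda>\<theta>. cis (- (real k * \<theta>))) \<in> borel_measurable borel"
      by (intro borel_measurable_continuous_onI continuous_intros)
    then show "(\<lambda>\<theta>. indicator {0..<2 * pi} \<theta> *\<^sub>R cis (- (real k * \<theta>))) \<in> borel_measurable lborel"
      "(\<lambda>\<theta>. indicator {0..2 * pi} \<theta> *\<^sub>R cis (- (real k * \<theta>))) \<in> borel_measurable lborel"
      by measurable
    show "AE \<theta> in lborel. indicat_real {0..<2 * pi} \<theta> *\<^sub>R cis (- (real k * \<theta>)) =
        indicat_real {0..2 * pi} \<theta> *\<^sub>R cis (- (real k * \<theta>))"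
      using AE_lborel_singleton[of "2 * pi"] by eventually_elim (auto split: split_indicator)
  qed
  also have "\<dots> = (if k = 0 then 2 * pi else 0)"
  proof (cases "k = 0")
    case False
    have "(\<integral>\<theta>. indicator {0..2 * pi} \<theta> *\<^sub>R cis (- (real k * \<theta>)) \<partial>lborel) =
       (\<i> / real k) * cis (- (real k * (2 * pi))) - (\<i> / real k) * cis (- (real k * 0))"
    proof (rule integral_FTC_Icc)
      fix \<theta> :: real
      have "((\<lambda>w. \<i> / of_nat k * exp (- (\<i> * of_nat k * w))) has_field_derivative
              exp (- (\<i> * of_nat k * of_real \<theta>))) (at (of_real \<theta>))"
        using False by (auto intro!: derivative_eq_intros)
      from has_vector_derivative_real_field[OF this]
      show "((\<lambda>\<theta>. \<i> / real k * cis (- (real k * \<theta>))) has_vector_derivative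
              cis (- (real k * \<theta>))) (at \<theta> within {0..2 * pi})"
        by (simp add: cis_conv_exp mult_ac)
    qed (auto intro!: continuous_intros)
    also have "cis (- (real k * (2 * pi))) = 1"
      using Complex.DeMoivre[of "- (2 * pi)" k] by (simp add: complex_eq_iff)
    finally show ?thesis using False by simp
  qed (simp add: scaleR_conv_of_real)
  finally show ?thesis .
qed

lemma orthogonality_torus_lebesgue:
  "(\<integral>z. z ^ i * cnj z ^ j \<partial>torus_lebesgue) = (if i = j then 2 * pi else 0)"
  by (simp add: integral_cnj_torus[OF radon_torus_lebesgue] integral_power_torus_lebesgue)

text \<open>
  The argument is continuous off the negative half-axis and takes the value \<open>pi\<close> on it, except at 0.
\<close>

lemma Arg_measurable: "Arg \<in> borel_measurable borel"
proof -
  have "Arg = (\<lambda>z. indicator (- \<real>\<^sub>\<le>\<^sub>0) z *\<^sub>R Arg z + (if z \<in> - \<real>\<^sub>\<le>\<^sub>0 \<or> z = 0 then 0 else pi))"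
  proof
    fix z
    show "Arg z = indicator (- \<real>\<^sub>\<le>\<^sub>0) z *\<^sub>R Arg z + (if z \<in> - \<real>\<^sub>\<le>\<^sub>0 \<or> z = 0 then 0 else pi)"
    proof (cases "z = 0")
      case False
      then show ?thesis
        by (cases "z \<in> \<real>\<^sub>\<le>\<^sub>0") (auto simp: Arg_eq_pi complex_nonpos_Reals_iff complex_eq_iff)
    qed (simp add: Arg_zero)
  qed
  also have "\<dots> \<in> borel_measurable borel"
    by (intro borel_measurable_add borel_measurable_continuous_on_indicator continuous_on_Arg) measurable
  finally show ?thesis .
qed

text \<open>
  The argument transports the measures to probability measures on \<open>{-pi<..pi}\<close>, a tight family; Helly's
  selection theorem gives a weak limit on the line, and \<open>cis\<close> carries it back. The argument jumps at
  \<open>-1\<close>, but only the functions \<open>f \<circ> cis\<close> are tested on the line, and these are continuous.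
\<close>

lemma torus_compactness:
  fixes \<mu> :: "nat \<Rightarrow> complex measure"
  assumes \<mu>: "\<And>n. radon_torus (\<mu> n)" and prob: "\<And>n. prob_space (\<mu> n)"
  shows "\<exists>r \<kappa>. strict_mono (r :: nat \<Rightarrow> nat) \<and> radon_torus \<kappa> \<and>
    (\<forall>f :: complex \<Rightarrow> complex. continuous_on (sphere 0 1) f \<longrightarrow>
      (\<lambda>n. integral\<^sup>L (\<mu> (r n)) f) \<longlonglongrightarrow> integral\<^sup>L \<kappa> f)"
proof -
  have Arg_meas: "Arg \<in> \<mu> n \<rightarrow>\<^sub>M borel" for n
  proof -
    have "Arg \<in> torus \<rightarrow>\<^sub>M borel"
      unfolding torus_def by (rule measurable_restrict_space1[OF Arg_measurable])
    then show ?thesis using measurable_cong_sets[OF radon_torus_sets[OF \<mu>] refl] by blast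
  qed
  define \<eta> where "\<eta> n = distr (\<mu> n) borel Arg" for n
  have real_distr: "real_distribution (\<eta> n)" for n
    unfolding \<eta>_def using prob_space.real_distribution_distr[OF prob Arg_meas] by simp
  have "tight \<eta>"
    unfolding tight_def
  proof (intro conjI allI impI)
    fix \<epsilon> :: real assume "\<epsilon> > 0"
    have "measure (\<eta> n) {-pi<..pi} = 1" for n
    proof -
      have "Arg -` {-pi<..pi} \<inter> space (\<mu> n) = space (\<mu> n)"
        using Arg_bounded by auto
      then show ?thesis
        unfolding \<eta>_def using Arg_meas prob_space.prob_space[OF prob] by (simp add: measure_distr)
    qed
    then show "\<exists>a b. a < b \<and> (\<forall>n. measure (\<eta> n) {a<..b} > 1 - \<epsilon>)"
      using \<open>\<epsilon> > 0\<close> by (intro exI[of _ "-pi"] exI[of _ pi]) auto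
  qed (rule real_distr)
  then obtain r K where r: "strict_mono r" and K: "real_distribution K" "weak_conv_m (\<eta> \<circ> id \<circ> r) K"
    using tight_imp_convergent_subsubsequence[of \<eta> id] by (auto simp: strict_mono_def)
  interpret K: real_distribution K by fact
  have cis_K: "cis \<in> K \<rightarrow>\<^sub>M torus" using cis_measurable_torus by simp
  define \<kappa> where "\<kappa> = distr K torus cis"
  have "radon_torus \<kappa>"
    unfolding radon_torus_def \<kappa>_def using K.finite_measure_distr[OF cis_K] by simp
  moreover have "(\<lambda>n. integral\<^sup>L (\<mu> (r n)) f) \<longlonglongrightarrow> integral\<^sup>L \<kappa> f"
    if f: "continuous_on (sphere 0 1) f" for f :: "complex \<Rightarrow> complex"
  proof -
    have "compact (f ` sphere 0 1)" using f by (intro compact_continuous_image) auto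
    then obtain B where B: "\<forall>x\<in>f ` sphere 0 1. norm x \<le> B" using compact_imp_bounded bounded_iff by metis
    have cont: "continuous_on UNIV (\<lambda>\<theta>. f (cis \<theta>))"
      by (rule continuous_on_compose2[OF f]) (auto intro!: continuous_intros)
    have "(\<lambda>n. integral\<^sup>L ((\<eta> \<circ> id \<circ> r) n) (\<lambda>\<theta>. f (cis \<theta>))) \<longlonglongrightarrow> integral\<^sup>L K (\<lambda>\<theta>. f (cis \<theta>))"
      using B cont by (intro weak_conv_imp_integral_bdd_continuous_conv[where B = B])
        (use K(2) in \<open>auto simp: real_distr K(1) o_def continuous_on_eq_continuous_at\<close>)
    moreover have "integral\<^sup>L (\<eta> n) (\<lambda>\<theta>. f (cis \<theta>)) = integral\<^sup>L (\<mu> n) f" for n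
    proof -
      have "integral\<^sup>L (\<eta> n) (\<lambda>\<theta>. f (cis \<theta>)) = (\<integral>z. f (cis (Arg z)) \<partial>\<mu> n)"
        unfolding \<eta>_def by (intro integral_distr Arg_meas borel_measurable_continuous_onI cont)
      also have "\<dots> = integral\<^sup>L (\<mu> n) f"
      proof (rule Bochner_Integration.integral_cong)
        fix z assume "z \<in> space (\<mu> n)"
        then have "cmod z = 1" by (simp add: radon_torus_space[OF \<mu>])
        then have "cis (Arg z) = z" by (subst cis_Arg) (auto simp: sgn_eq)
        then show "f (cis (Arg z)) = f z" by simp
      qed simp
      finally show ?thesis .
    qed
    moreover have "integral\<^sup>L \<kappa> f = integral\<^sup>L K (\<lambda>\<theta>. f (cis \<theta>))"
      unfolding \<kappa>_def by (intro integral_distr cis_K continuous_measurable_torus f) simp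
    ultimately show ?thesis by simp
  qed
  ultimately show ?thesis using r by blast
qed

lemma radon_torus_density:
  assumes \<mu>: "radon_torus \<mu>" and f: "integrable \<mu> f" "\<And>z. z \<in> sphere 0 1 \<Longrightarrow> 0 \<le> f z"
  shows "radon_torus (density \<mu> (\<lambda>z. ennreal (f z)))"
    and "measure (density \<mu> (\<lambda>z. ennreal (f z))) (sphere 0 1) = integral\<^sup>L \<mu> f"
proof -
  have f': "AE z in \<mu>. 0 \<le> f z" using f(2) by (auto simp: radon_torus_space[OF \<mu>])
  have *: "emeasure (density \<mu> (\<lambda>z. ennreal (f z))) (space \<mu>) = ennreal (integral\<^sup>L \<mu> f)"
  proof -
    have "emeasure (density \<mu> (\<lambda>z. ennreal (f z))) (space \<mu>) = (\<integral>\<^sup>+z. ennreal (f z) \<partial>\<mu>)"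
      using f(1) by (subst emeasure_density) (auto intro!: nn_integral_cong)
    then show ?thesis using nn_integral_eq_integral[OF f(1) f'] by simp
  qed
  show "radon_torus (density \<mu> (\<lambda>z. ennreal (f z)))"
    unfolding radon_torus_def using * by (auto simp: radon_torus_sets[OF \<mu>] intro!: finite_measureI)
  show "measure (density \<mu> (\<lambda>z. ennreal (f z))) (sphere 0 1) = integral\<^sup>L \<mu> f"
    using * integral_nonneg_AE[OF f'] by (simp add: measure_def radon_torus_space[OF \<mu>])
qed

text \<open>
  Positivity of the form at the vector \<open>u m = cnj z ^ m\<close> says that the Fejer means of the sequence are
  nonnegative functions of \<open>z\<close>. The measures with these densities have total mass \<open>a 0\<close>, and their
  \<open>k\<close>-th Fourier coefficient is \<open>(1 - k / N) * a k\<close> for \<open>k \<le> N\<close>. Any weak limit point has the coefficients \<open>a k\<close>.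
\<close>

theorem Herglotz:
  fixes a :: "int \<Rightarrow> complex"
  assumes pos: "\<And>N u. (\<Sum>m<N. \<Sum>n<N. u m * cnj (u n) * a (int n - int m)) \<in> \<real>\<^sub>\<ge>\<^sub>0"
  shows "\<exists>\<mu>. radon_torus \<mu> \<and> (\<forall>k. (\<integral>z. cnj z ^ k \<partial>\<mu>) = a (int k))"
proof -
  \<comment> \<open>The Fejer mean of order \<open>N\<close>, normalised by the total mass \<open>2 * pi\<close> of the Lebesgue measure.\<close>
  define F where "F N z = (\<Sum>m<N. \<Sum>n<N. cnj z ^ m * z ^ n * a (int n - int m)) / (2 * pi * N)" for N z
  define f where "f N z = Re (F N z)" for N z
  have f_F: "complex_of_real (f N z) = F N z" and f_nonneg: "0 \<le> f N z" for N z
  proof -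
    have "(\<Sum>m<N. \<Sum>n<N. cnj z ^ m * z ^ n * a (int n - int m)) \<in> \<real>\<^sub>\<ge>\<^sub>0"
      using pos[of "\<lambda>m. cnj z ^ m" N] by simp
    then have "F N z \<in> \<real>\<^sub>\<ge>\<^sub>0"
      unfolding F_def by (intro nonneg_Reals_divide_I) auto
    then show "complex_of_real (f N z) = F N z" "0 \<le> f N z"
      by (auto simp: f_def nonneg_Reals_def)
  qed
  have F_cont: "continuous_on A (F N)" for A N
    unfolding F_def by (cases "N = 0") (auto intro!: continuous_intros)
  then have f_cont: "continuous_on A (f N)" for A N
    unfolding f_def by (auto intro!: continuous_intros)
  have f_int: "integrable torus_lebesgue (f N)" for N
    by (intro continuous_integrable_torus f_cont radon_torus_lebesgue)
  define \<mu> where "\<mu> N = density torus_lebesgue (\<lambda>z. ennreal (f N z))" for N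
  have \<mu>: "radon_torus (\<mu> N)" for N
    unfolding \<mu>_def by (intro radon_torus_density f_int f_nonneg radon_torus_lebesgue)
  have Fejer: "(\<integral>z. cnj z ^ k \<partial>\<mu> N) = of_nat (N - k) / N * a (int k)" if "N > 0" for N k
  proof -
    have "(\<integral>z. cnj z ^ k \<partial>\<mu> N) = (\<integral>z. f N z *\<^sub>R cnj z ^ k \<partial>torus_lebesgue)"
      unfolding \<mu>_def using f_int[of N]
      by (intro integral_density continuous_measurable_torus continuous_intros)
        (auto simp: radon_torus_sets radon_torus_lebesgue f_nonneg f_cont)
    also have "\<dots> = (\<integral>z. (\<Sum>m<N. \<Sum>n<N. a (int n - int m) / (2 * pi * N) * (z ^ n * cnj z ^ (m + k))) \<partial>torus_lebesgue)"
      by (simp add: scaleR_conv_of_real f_F F_def sum_divide_distrib sum_distrib_right sum_distrib_left power_add mult_ac)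
    also have "\<dots> = (\<Sum>m<N. \<Sum>n<N. a (int n - int m) / (2 * pi * N) * (if n = m + k then 2 * pi else 0))"
      by (simp add: Bochner_Integration.integral_sum continuous_integrable_torus radon_torus_lebesgue
          continuous_intros orthogonality_torus_lebesgue)
    also have "\<dots> = (\<Sum>m<N. if m + k < N then a (int k) / N else 0)"
    proof (intro sum.cong refl)
      fix m
      have "(\<Sum>n<N. a (int n - int m) / (2 * pi * N) * (if n = m + k then 2 * pi else 0)) =
        (\<Sum>n<N. if n = m + k then a (int n - int m) / N else 0)"
        by (intro sum.cong) auto
      then show "(\<Sum>n<N. a (int n - int m) / (2 * pi * N) * (if n = m + k then 2 * pi else 0)) =
        (if m + k < N then a (int k) / N else 0)"
        by simp
    qed
    also have "\<dots> = (\<Sum>m<N - k. a (int k) / N)"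
      by (intro sum.mono_neutral_cong_right) auto
    finally show ?thesis by simp
  qed
  have total: "complex_of_real (measure (\<mu> N) (sphere 0 1)) = a 0" if "N > 0" for N
    using Fejer[OF that, of 0] that radon_torus_space[OF \<mu>[of N]] by (simp add: scaleR_conv_of_real)
  show ?thesis
  \<comment> \<open>Compactness needs probability measures. With \<open>a 0 = 0\<close> the Fejer measures vanish, and so do all
    coefficients.\<close>
  proof (cases "a 0 = 0")
    case True
    have "a (int k) = 0" for k
    proof -
      interpret finite_measure "\<mu> (Suc k)" using \<mu> by (rule radon_torus_finite)
      have "emeasure (\<mu> (Suc k)) (space (\<mu> (Suc k))) = 0"
        using total[of "Suc k"] True by (simp add: emeasure_eq_measure radon_torus_space[OF \<mu>])
      then have "AE z in \<mu> (Suc k). False" by (intro AE_I[where N = "space (\<mu> (Suc k))"]) auto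
      then have "(\<integral>z. cnj z ^ k \<partial>\<mu> (Suc k)) = 0" by (intro integral_eq_zero_AE) auto
      then show ?thesis using Fejer[of "Suc k" k] by (simp add: Suc_diff_le del: of_nat_Suc)
    qed
    moreover have "radon_torus (null_measure torus)"
      by (auto simp: radon_torus_def intro!: finite_measureI)
    ultimately show ?thesis by (intro exI[of _ "null_measure torus"]) simp
  next
    case False
    define c where "c = measure (\<mu> 1) (sphere 0 1)"
    have a0: "a 0 = complex_of_real c" using total[of 1] by (simp add: c_def)
    then have c: "c > 0" using False by (simp add: c_def less_le)
    have meas_c: "measure (\<mu> (Suc N)) (sphere 0 1) = c" for N
      using total[of "Suc N"] a0 by simp
    \<comment> \<open>The shift to \<open>Suc N\<close> avoids the mean of order 0, a division by zero and hence of mass 0.\<close>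
    define \<nu> where "\<nu> N = density (\<mu> (Suc N)) (\<lambda>_. ennreal (1 / c))" for N
    have \<nu>: "radon_torus (\<nu> N)" and "measure (\<nu> N) (sphere 0 1) = 1" for N
      using radon_torus_density[OF \<mu>[of "Suc N"], of "\<lambda>_. 1 / c"] c meas_c[of N]
        finite_measure.integrable_const[OF radon_torus_finite[OF \<mu>]]
      by (auto simp: \<nu>_def radon_torus_space[OF \<mu>])
    then have "prob_space (\<nu> N)" for N
      using finite_measure.emeasure_eq_measure[OF radon_torus_finite[OF \<nu>]]
      by (intro prob_spaceI) (simp add: radon_torus_space[OF \<nu>])
    from torus_compactness[of \<nu>, OF \<nu> this]
    obtain r \<kappa> where r: "strict_mono r" and \<kappa>: "radon_torus \<kappa>"
      and lim: "\<forall>f :: complex \<Rightarrow> complex. continuous_on (sphere 0 1) f \<longrightarrow>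
                  (\<lambda>n. integral\<^sup>L (\<nu> (r n)) f) \<longlonglongrightarrow> integral\<^sup>L \<kappa> f"
      by (elim exE conjE)
    have \<kappa>_hat: "(\<integral>z. cnj z ^ k \<partial>\<kappa>) = a (int k) / c" for k
    proof (rule LIMSEQ_unique)
      show "(\<lambda>n. \<integral>z. cnj z ^ k \<partial>\<nu> (r n)) \<longlonglongrightarrow> (\<integral>z. cnj z ^ k \<partial>\<kappa>)"
        by (intro lim[rule_format] continuous_intros)
      have "(\<integral>z. cnj z ^ k \<partial>\<nu> N) = of_real (real (Suc N - k) / real (Suc N)) * (a (int k) / c)" for N
      proof -
        have "(\<integral>z. cnj z ^ k \<partial>\<nu> N) = (\<integral>z. (1 / c) *\<^sub>R cnj z ^ k \<partial>\<mu> (Suc N))"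
          unfolding \<nu>_def using c
          by (intro integral_density continuous_measurable_torus continuous_intros radon_torus_sets \<mu>) auto
        then show ?thesis using Fejer[of "Suc N" k] by (simp add: scaleR_conv_of_real)
      qed
      moreover have "(\<lambda>N. real (Suc N - k) / real (Suc N)) \<longlonglongrightarrow> 1"
      proof -
        have "(\<lambda>N. 1 - real k / real (Suc N)) \<longlonglongrightarrow> 1 - 0"
          by (intro tendsto_intros LIMSEQ_Suc[OF lim_const_over_n])
        moreover have "\<forall>\<^sub>F N in sequentially. 1 - real k / real (Suc N) = real (Suc N - k) / real (Suc N)"
          using eventually_ge_at_top[of k] by eventually_elim (simp add: field_simps of_nat_diff)
        ultimately show ?thesis using tendsto_cong by force
      qed
      then have "(\<lambda>N. of_real (real (Suc N - k) / real (Suc N)) * (a (int k) / c)) \<longlonglongrightarrow> of_real 1 * (a (int k) / c)"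
        by (intro tendsto_intros)
      ultimately have "(\<lambda>N. \<integral>z. cnj z ^ k \<partial>\<nu> N) \<longlonglongrightarrow> a (int k) / c" by simp
      from LIMSEQ_subseq_LIMSEQ[OF this r]
      show "(\<lambda>n. \<integral>z. cnj z ^ k \<partial>\<nu> (r n)) \<longlonglongrightarrow> a (int k) / c" by (simp add: o_def)
    qed
    show ?thesis
    proof (intro exI conjI allI)
      show "radon_torus (density \<kappa> (\<lambda>_. ennreal c))"
        using c finite_measure.integrable_const[OF radon_torus_finite[OF \<kappa>]]
        by (intro radon_torus_density \<kappa>) auto
      fix k
      have "(\<integral>z. cnj z ^ k \<partial>density \<kappa> (\<lambda>_. ennreal c)) = (\<integral>z. c *\<^sub>R cnj z ^ k \<partial>\<kappa>)"
        using c by (intro integral_density continuous_measurable_torus continuous_intros radon_torus_sets \<kappa>) auto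
      then show "(\<integral>z. cnj z ^ k \<partial>density \<kappa> (\<lambda>_. ennreal c)) = a (int k)"
        using c by (simp add: \<kappa>_hat scaleR_conv_of_real)
    qed
  qed
qed


section \<open>Convolution with the Poisson kernel\<close>

lemma poisson_kernel_nonneg: "0 \<le> r \<Longrightarrow> r < 1 \<Longrightarrow> 0 \<le> poisson_kernel r z"
  by (simp add: poisson_kernel_def power_le_one)

lemma norm_one_minus_ge: "0 \<le> r \<Longrightarrow> cmod z = 1 \<Longrightarrow> 1 - r \<le> cmod (1 - of_real r * z)"
  using norm_triangle_ineq2[of 1 "of_real r * z"] by (simp add: norm_mult)

lemma poisson_kernel_le:
  assumes "0 \<le> r" "r < 1" "cmod z = 1"
  shows "poisson_kernel r z \<le> 1 / (2 * pi) * ((1 - r\<^sup>2) / (1 - r)\<^sup>2)"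
  unfolding poisson_kernel_def
  using assms norm_one_minus_ge[of r z]
  by (intro mult_left_mono divide_left_mono power_mono mult_pos_pos zero_less_power)
    (auto simp: power_le_one)

text \<open>
  The Fourier series of the kernel, with the frequencies \<open>n\<close> and \<open>- (n + 1)\<close> grouped into one term: two
  geometric series, with ratios \<open>r * z\<close> and its conjugate.
\<close>

lemma poisson_kernel_sums:
  assumes r: "0 \<le> r" "r < 1" and z: "cmod z = 1"
  shows "(\<lambda>n. (of_real r * z) ^ n + (of_real r * cnj z) ^ Suc n) sums of_real (2 * pi * poisson_kernel r z)"
proof -
  let ?a = "of_real r * z"
  have a: "cmod ?a < 1" and b: "cmod (cnj ?a) < 1" using r z by (simp_all add: norm_mult)
  have ne: "1 - ?a \<noteq> 0" "1 - cnj ?a \<noteq> 0" using a b by auto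
  have zz: "z * cnj z = 1" using z by (simp add: complex_norm_square[symmetric])
  have "(\<lambda>n. ?a ^ n + cnj ?a * cnj ?a ^ n) sums (1 / (1 - ?a) + cnj ?a * (1 / (1 - cnj ?a)))"
    by (intro sums_add sums_mult geometric_sums a b)
  also have "1 / (1 - ?a) + cnj ?a * (1 / (1 - cnj ?a)) = (1 - ?a * cnj ?a) / ((1 - ?a) * (1 - cnj ?a))"
    using ne by (simp add: divide_simps) (simp add: algebra_simps)
  also have "\<dots> = of_real ((1 - r\<^sup>2) / (cmod (1 - ?a))\<^sup>2)"
    using zz complex_norm_square[of "1 - ?a"] by (simp add: power2_eq_square mult_ac)
  finally show ?thesis by (simp add: poisson_kernel_def)
qed

text \<open>
  Integrating the Fourier series of the kernel term by term leaves only the frequency \<open>k\<close>; the series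
  is dominated by a geometric one.
\<close>

lemma Fourier_poisson_kernel:
  assumes r: "0 \<le> r" "r < 1" and z: "cmod z = 1"
  shows "(\<integral>w. of_real (poisson_kernel r (w / z)) * cnj w ^ k \<partial>torus_lebesgue) = of_real (r ^ k) * cnj z ^ k"
proof -
  \<comment> \<open>The second exponent of \<open>cnj w\<close> is \<open>Suc n + k > 0\<close>, so the conjugate half of the series never
    contributes to the integral.\<close>
  define t where "t n w = ((of_real r * cnj z) ^ n * (w ^ n * cnj w ^ k) +
      (of_real r * z) ^ Suc n * (w ^ 0 * cnj w ^ (Suc n + k))) / (2 * pi)" for n w
  have zdiv: "w / z = cnj z * w" for w using complex_div_cnj[of w z] z by (simp add: mult.commute)
  have t_sums: "(\<lambda>n. t n w) sums (of_real (poisson_kernel r (w / z)) * cnj w ^ k)" if w: "cmod w = 1" for w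
  proof -
    have "(\<lambda>n. ((of_real r * (w / z)) ^ n + (of_real r * cnj (w / z)) ^ Suc n) * (cnj w ^ k / (2 * pi))) sums
      (of_real (2 * pi * poisson_kernel r (w / z)) * (cnj w ^ k / (2 * pi)))"
      using z w by (intro sums_mult2 poisson_kernel_sums r) (simp add: norm_divide)
    also have "(\<lambda>n. ((of_real r * (w / z)) ^ n + (of_real r * cnj (w / z)) ^ Suc n) * (cnj w ^ k / (2 * pi))) = (\<lambda>n. t n w)"
      by (auto simp: fun_eq_iff t_def zdiv power_mult_distrib power_add field_simps)
    finally show ?thesis by simp
  qed
  have t_int: "integrable torus_lebesgue (t n)" for n
    unfolding t_def by (intro continuous_integrable_torus radon_torus_lebesgue continuous_intros) auto
  have t_norm: "cmod (t n w) \<le> r ^ n" if w: "cmod w = 1" for n w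
  proof -
    have "cmod (t n w) \<le> (r ^ n + r ^ Suc n) / (2 * pi)"
      unfolding t_def norm_divide using r z w
      by (intro frac_le order.trans[OF norm_triangle_ineq]) (auto simp: norm_mult norm_power)
    also have "\<dots> \<le> (r ^ n + r ^ n) / 2"
      using r pi_gt3 by (intro frac_le add_mono) (auto simp: mult_left_le_one_le)
    finally show ?thesis by simp
  qed
  interpret finite_measure torus_lebesgue by (rule radon_torus_finite[OF radon_torus_lebesgue])
  have sp: "space torus_lebesgue = sphere 0 1" by (rule radon_torus_space[OF radon_torus_lebesgue])
  have "(\<lambda>n. integral\<^sup>L torus_lebesgue (t n)) sums (\<integral>w. (\<Sum>n. t n w) \<partial>torus_lebesgue)"
  proof (rule sums_integral[OF t_int])
    show "AE w in torus_lebesgue. summable (\<lambda>n. norm (t n w))"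
    proof (rule AE_I2, rule summable_comparison_test')
      show "summable (\<lambda>n. r ^ n)" using r by (intro summable_geometric) auto
    qed (auto simp: sp t_norm)
    show "summable (\<lambda>n. \<integral>w. norm (t n w) \<partial>torus_lebesgue)"
    proof (rule summable_comparison_test')
      show "summable (\<lambda>n. r ^ n * measure torus_lebesgue (space torus_lebesgue))"
        using r by (intro summable_mult2 summable_geometric) auto
      show "norm (\<integral>w. norm (t n w) \<partial>torus_lebesgue) \<le> r ^ n * measure torus_lebesgue (space torus_lebesgue)" for n
        using integral_mono[of torus_lebesgue "\<lambda>w. norm (t n w)" "\<lambda>_. r ^ n"] t_int[of n] t_norm
        by (simp add: sp mult.commute)
    qed
  qed
  also have "(\<integral>w. (\<Sum>n. t n w) \<partial>torus_lebesgue) = (\<integral>w. of_real (poisson_kernel r (w / z)) * cnj w ^ k \<partial>torus_lebesgue)"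
    by (intro Bochner_Integration.integral_cong refl sums_unique[symmetric] t_sums) (simp add: sp)
  finally have sums: "(\<lambda>n. integral\<^sup>L torus_lebesgue (t n)) sums \<dots>" .
  have "integral\<^sup>L torus_lebesgue (t n) = (if n = k then of_real (r ^ k) * cnj z ^ k else 0)" for n
  proof -
    have i: "integrable torus_lebesgue (\<lambda>w. c * (w ^ i * cnj w ^ j))" for c i j
      by (intro continuous_integrable_torus radon_torus_lebesgue continuous_intros)
    have "integral\<^sup>L torus_lebesgue (t n) =
      ((of_real r * cnj z) ^ n * (\<integral>w. w ^ n * cnj w ^ k \<partial>torus_lebesgue) +
      (of_real r * z) ^ Suc n * (\<integral>w. w ^ 0 * cnj w ^ (Suc n + k) \<partial>torus_lebesgue)) / (2 * pi)"
      unfolding t_def integral_divide_zero using Bochner_Integration.integral_add[OF i i]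
      by (simp only: integral_mult_right_zero)
    also have "\<dots> = (if n = k then of_real (r ^ k) * cnj z ^ k else 0)"
      unfolding orthogonality_torus_lebesgue by (simp add: power_mult_distrib)
    finally show ?thesis .
  qed
  then have "(\<lambda>n. integral\<^sup>L torus_lebesgue (t n)) sums (of_real (r ^ k) * cnj z ^ k)"
    using sums_single[of k "\<lambda>_. of_real (r ^ k) * cnj z ^ k"] by simp
  with sums show ?thesis by (rule sums_unique2)
qed

text \<open>
  Convolution multiplies Fourier coefficients. After Fubini, which applies because the kernel is bounded
  for \<open>r < 1\<close>, the inner integral is the Fourier coefficient of a rotated Poisson kernel.
\<close>

lemma
  assumes r: "0 \<le> r" "r < 1" and \<mu>: "radon_torus \<mu>"
  shows radon_torus_poisson_conv_measure: "radon_torus (poisson_conv_measure r \<mu>)"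
    and Fourier_poisson_conv_measure:
      "(\<integral>w. cnj w ^ k \<partial>poisson_conv_measure r \<mu>) = of_real (r ^ k) * (\<integral>z. cnj z ^ k \<partial>\<mu>)"
proof -
  interpret \<mu>: finite_measure \<mu> using \<mu> by (rule radon_torus_finite)
  interpret L: finite_measure torus_lebesgue by (rule radon_torus_finite[OF radon_torus_lebesgue])
  interpret P: pair_sigma_finite torus_lebesgue \<mu> ..
  interpret PF: finite_measure "torus_lebesgue \<Otimes>\<^sub>M \<mu>"
    by (rule finite_measure_pair_measure) unfold_locales
  have id_meas: "(\<lambda>z. z) \<in> borel_measurable \<kappa>" if "radon_torus \<kappa>" for \<kappa>
    using that by (intro continuous_measurable_torus continuous_intros) (rule radon_torus_sets)
  note [measurable] = measurable_compose[OF measurable_fst id_meas[OF radon_torus_lebesgue]]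
    measurable_compose[OF measurable_snd id_meas[OF \<mu>]] id_meas[OF radon_torus_lebesgue] id_meas[OF \<mu>]
  have sp: "space torus_lebesgue = sphere 0 1" "space \<mu> = sphere 0 1"
    using \<mu> radon_torus_lebesgue by (auto simp: radon_torus_space)
  define B where "B = 1 / (2 * pi) * ((1 - r\<^sup>2) / (1 - r)\<^sup>2)"
  have le_B: "\<bar>poisson_kernel r (w / z)\<bar> \<le> B" if "cmod w = 1" "cmod z = 1" for w z
    using poisson_kernel_le[OF r, of "w / z"] poisson_kernel_nonneg[OF r, of "w / z"] that
    by (simp add: B_def norm_divide)
  have meas: "(\<lambda>p. poisson_kernel r (fst p / snd p)) \<in> borel_measurable (torus_lebesgue \<Otimes>\<^sub>M \<mu>)"
    unfolding poisson_kernel_def by measurable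
  have int: "integrable (torus_lebesgue \<Otimes>\<^sub>M \<mu>) (\<lambda>p. poisson_kernel r (fst p / snd p))"
    using meas by (intro PF.integrable_const_bound[where B = B]) (auto simp: space_pair_measure sp le_B)
  have intk: "integrable (torus_lebesgue \<Otimes>\<^sub>M \<mu>) (\<lambda>p. of_real (poisson_kernel r (fst p / snd p)) * cnj (fst p) ^ k)" for k
  proof (rule PF.integrable_const_bound[where B = B])
    have [measurable]: "cnj \<in> borel_measurable borel"
      by (intro borel_measurable_continuous_onI continuous_intros)
    show "(\<lambda>p. of_real (poisson_kernel r (fst p / snd p)) * cnj (fst p) ^ k) \<in> borel_measurable (torus_lebesgue \<Otimes>\<^sub>M \<mu>)"
      using meas by measurable
  qed (auto simp: space_pair_measure sp le_B norm_mult norm_power)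
  have conv_int: "integrable torus_lebesgue (poisson_conv r \<mu>)"
    using P.integrable_fst'[OF int] by (simp add: poisson_conv_def[abs_def])
  have conv_nonneg: "0 \<le> poisson_conv r \<mu> w" for w
    unfolding poisson_conv_def by (intro Bochner_Integration.integral_nonneg poisson_kernel_nonneg r)
  show "radon_torus (poisson_conv_measure r \<mu>)"
    unfolding poisson_conv_measure_def
    by (intro radon_torus_density radon_torus_lebesgue conv_int conv_nonneg)
  have cnj_meas: "(\<lambda>w. cnj w ^ k) \<in> borel_measurable torus_lebesgue"
    by (intro continuous_measurable_torus continuous_intros radon_torus_sets radon_torus_lebesgue)
  have "(\<integral>w. cnj w ^ k \<partial>poisson_conv_measure r \<mu>) = (\<integral>w. poisson_conv r \<mu> w *\<^sub>R cnj w ^ k \<partial>torus_lebesgue)"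
    unfolding poisson_conv_measure_def using conv_int conv_nonneg
    by (intro integral_density cnj_meas) auto
  also have "\<dots> = (\<integral>w. (\<integral>z. of_real (poisson_kernel r (w / z)) * cnj w ^ k \<partial>\<mu>) \<partial>torus_lebesgue)"
    by (simp add: poisson_conv_def scaleR_conv_of_real)
  also have "\<dots> = (\<integral>z. (\<integral>w. of_real (poisson_kernel r (w / z)) * cnj w ^ k \<partial>torus_lebesgue) \<partial>\<mu>)"
    using P.Fubini_integral[of "\<lambda>w z. of_real (poisson_kernel r (w / z)) * cnj w ^ k"] intk[of k]
    by (simp add: case_prod_unfold)
  also have "\<dots> = (\<integral>z. of_real (r ^ k) * cnj z ^ k \<partial>\<mu>)"
    by (intro Bochner_Integration.integral_cong refl Fourier_poisson_kernel r) (simp add: sp)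
  finally show "(\<integral>w. cnj w ^ k \<partial>poisson_conv_measure r \<mu>) = of_real (r ^ k) * (\<integral>z. cnj z ^ k \<partial>\<mu>)"
    by simp
qed


section \<open>From a branching process to a measure\<close>

lemma integrable_mult_cnj:
  fixes f g :: "'w \<Rightarrow> complex"
  assumes [measurable]: "f \<in> borel_measurable M" "g \<in> borel_measurable M"
    and sq: "integrable M (\<lambda>\<omega>. (cmod (f \<omega>))\<^sup>2)" "integrable M (\<lambda>\<omega>. (cmod (g \<omega>))\<^sup>2)"
  shows "integrable M (\<lambda>\<omega>. f \<omega> * cnj (g \<omega>))"
proof (rule Bochner_Integration.integrable_bound)
  show "integrable M (\<lambda>\<omega>. (cmod (f \<omega>))\<^sup>2 + (cmod (g \<omega>))\<^sup>2)"
    using sq by (rule Bochner_Integration.integrable_add)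
  have [measurable]: "cnj \<in> borel_measurable borel"
    by (intro borel_measurable_continuous_onI continuous_intros)
  show "(\<lambda>\<omega>. f \<omega> * cnj (g \<omega>)) \<in> borel_measurable M" by measurable
  have "x * y \<le> x\<^sup>2 + y\<^sup>2" if "0 \<le> x" "0 \<le> y" for x y :: real
    using sum_squares_bound[of x y] that mult_nonneg_nonneg[of x y] by linarith
  then show "AE \<omega> in M. norm (f \<omega> * cnj (g \<omega>)) \<le> norm ((cmod (f \<omega>))\<^sup>2 + (cmod (g \<omega>))\<^sup>2)"
    by (auto simp: norm_mult)
qed

lemma cov_cnj: "cov M Y X = cnj (cov M X Y)"
  by (simp add: cov_def mult.commute flip: Bochner_Integration.integral_cnj)

lemma cov_sum_sum:
  assumes X: "mean_zero_L2_process M I X" and AB: "A \<subseteq> I" "B \<subseteq> I"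
  shows "cov M (\<lambda>\<omega>. \<Sum>i\<in>A. u i * X i \<omega>) (\<lambda>\<omega>. \<Sum>j\<in>B. v j * X j \<omega>) =
    (\<Sum>i\<in>A. \<Sum>j\<in>B. u i * cnj (v j) * cov M (X i) (X j))"
proof -
  have int: "integrable M (\<lambda>\<omega>. c * (X i \<omega> * cnj (X j \<omega>)))" if "i \<in> I" "j \<in> I" for c i j
    using X that by (intro integrable_mult_right integrable_mult_cnj) (auto simp: mean_zero_L2_process_def)
  have product: "(\<Sum>i\<in>A. u i * x i) * cnj (\<Sum>j\<in>B. v j * x j) =
      (\<Sum>i\<in>A. \<Sum>j\<in>B. u i * cnj (v j) * (x i * cnj (x j)))" for x
    unfolding cnj_sum sum_product by (intro sum.cong refl) (simp add: mult_ac)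
  have "cov M (\<lambda>\<omega>. \<Sum>i\<in>A. u i * X i \<omega>) (\<lambda>\<omega>. \<Sum>j\<in>B. v j * X j \<omega>) =
    (\<integral>\<omega>. (\<Sum>i\<in>A. \<Sum>j\<in>B. u i * cnj (v j) * (X i \<omega> * cnj (X j \<omega>))) \<partial>M)"
    unfolding cov_def product ..
  also have "\<dots> = (\<Sum>i\<in>A. \<integral>\<omega>. (\<Sum>j\<in>B. u i * cnj (v j) * (X i \<omega> * cnj (X j \<omega>))) \<partial>M)"
    using AB by (intro Bochner_Integration.integral_sum Bochner_Integration.integrable_sum int) auto
  also have "\<dots> = (\<Sum>i\<in>A. \<Sum>j\<in>B. \<integral>\<omega>. u i * cnj (v j) * (X i \<omega> * cnj (X j \<omega>)) \<partial>M)"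
    using AB by (intro sum.cong refl Bochner_Integration.integral_sum int) auto
  finally show ?thesis by (simp add: cov_def)
qed

text \<open>
  The conditions on all rays amount to conditions on pairs of vertices: a descendant at distance \<open>k\<close> has
  covariance the \<open>k\<close>-th Fourier coefficient, and incomparable vertices are uncorrelated. Both directions
  of the theorem use only this form.
\<close>

lemma branching_spectral_measure_iff:
  assumes q: "q > 0"
  shows "branching_spectral_measure M (Tq_vertices q) (Tq_edges q) [] X \<nu> \<longleftrightarrow>
    mean_zero_L2_process M (Tq_vertices q) X \<and> radon_torus \<nu> \<and>
    (\<forall>\<sigma> \<rho>. \<sigma> @ \<rho> \<in> Tq_vertices q \<longrightarrow> cov M (X \<sigma>) (X (\<sigma> @ \<rho>)) = (\<integral>z. cnj z ^ length \<rho> \<partial>\<nu>)) \<and>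
    (\<forall>\<sigma>\<in>Tq_vertices q. \<forall>\<tau>\<in>Tq_vertices q. \<not> prefix \<sigma> \<tau> \<and> \<not> prefix \<tau> \<sigma> \<longrightarrow> cov M (X \<sigma>) (X \<tau>) = 0)"
    (is "?L \<longleftrightarrow> ?R")
proof
  assume L: ?L
  then have spec: "has_spectral_measure M (\<lambda>n. X (\<xi> n)) \<nu>"
    if "\<xi> \<in> rooted_rays (Tq_vertices q) (Tq_edges q) []" for \<xi>
    using that by (auto simp: branching_spectral_measure_def)
  have "[] \<in> Tq_vertices q" by (simp add: Tq_vertices_def)
  then have "radon_torus \<nu>"
    using ray_through[OF _ q] spec by (metis has_spectral_measure_def)
  moreover have "cov M (X \<sigma>) (X (\<sigma> @ \<rho>)) = (\<integral>z. cnj z ^ length \<rho> \<partial>\<nu>)" if V: "\<sigma> @ \<rho> \<in> Tq_vertices q" for \<sigma> \<rho>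
  proof -
    obtain \<xi> where \<xi>: "\<xi> \<in> rooted_rays (Tq_vertices q) (Tq_edges q) []"
      and take: "\<And>m. m \<le> length (\<sigma> @ \<rho>) \<Longrightarrow> \<xi> m = take m (\<sigma> @ \<rho>)"
      using ray_through[OF V q] by blast
    have "cov M (X (\<xi> (length \<sigma>))) (X (\<xi> (length \<sigma> + length \<rho>))) = (\<integral>z. cnj z ^ length \<rho> \<partial>\<nu>)"
      using spec[OF \<xi>] by (simp add: has_spectral_measure_def)
    then show ?thesis using take[of "length \<sigma>"] take[of "length \<sigma> + length \<rho>"] by simp
  qed
  ultimately show ?R
    using L comparable_iff_prefix[OF _ _ q]
    by (auto simp: branching_spectral_measure_def branching_stationary_def)
next
  assume R: ?R
  have cov_ray: "cov M (X (\<xi> n)) (X (\<xi> (n + k))) = (\<integral>z. cnj z ^ k \<partial>\<nu>)" and V: "\<xi> n \<in> Tq_vertices q"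
    if \<xi>: "\<xi> \<in> rooted_rays (Tq_vertices q) (Tq_edges q) []" for \<xi> n k
  proof -
    have V: "\<xi> n \<in> Tq_vertices q" for n using \<xi> by (simp add: rooted_rays_def)
    then show "\<xi> n \<in> Tq_vertices q" .
    define \<rho> where "\<rho> = drop n (\<xi> (n + k))"
    have "\<xi> (n + k) = \<xi> n @ \<rho>" "length \<rho> = k"
      using ray_take(2)[OF \<xi>, of n "n + k"] ray_take(1)[OF \<xi>, of "n + k"] by (auto simp: \<rho>_def)
    then show "cov M (X (\<xi> n)) (X (\<xi> (n + k))) = (\<integral>z. cnj z ^ k \<partial>\<nu>)"
      using R V[of "n + k"] by metis
  qed
  have spec: "has_spectral_measure M (\<lambda>n. X (\<xi> n)) \<nu>" and "stationary_process M (\<lambda>n. X (\<xi> n))"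
    if "\<xi> \<in> rooted_rays (Tq_vertices q) (Tq_edges q) []" for \<xi>
    using R cov_ray[OF that] V[OF that]
    by (auto simp: has_spectral_measure_def stationary_process_def mean_zero_L2_process_def)
  with R show ?L
    using comparable_iff_prefix[OF _ _ q]
    by (auto simp: branching_spectral_measure_def branching_stationary_def)
qed

lemma
  shows finite_Tq_level: "finite {\<sigma> \<in> Tq_vertices q. length \<sigma> = n}"
    and card_Tq_level: "card {\<sigma> \<in> Tq_vertices q. length \<sigma> = n} = q ^ n"
proof -
  have "{\<sigma> \<in> Tq_vertices q. length \<sigma> = n} = {\<sigma>. set \<sigma> \<subseteq> {..<q} \<and> length \<sigma> = n}"
    by (auto simp: Tq_vertices_def)
  then show "finite {\<sigma> \<in> Tq_vertices q. length \<sigma> = n}" "card {\<sigma> \<in> Tq_vertices q. length \<sigma> = n} = q ^ n"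
    using card_lists_length_eq[of "{..<q}" n] finite_lists_length_eq[of "{..<q}" n] by simp_all
qed

text \<open>
  The factor \<open>q\<close> to the power \<open>- n / 2\<close> makes the variances of all these sums equal, since level \<open>n\<close> has
  \<open>q ^ n\<close> pairwise uncorrelated vertices.
\<close>

definition normalized_level_sum :: "nat \<Rightarrow> (nat list \<Rightarrow> 'w \<Rightarrow> complex) \<Rightarrow> nat \<Rightarrow> 'w \<Rightarrow> complex" where
  "normalized_level_sum q X n \<omega> = (\<Sum>\<sigma> | \<sigma> \<in> Tq_vertices q \<and> length \<sigma> = n. of_real (1 / sqrt q ^ n) * X \<sigma> \<omega>)"

text \<open>
  A vertex of level \<open>n + k\<close> has exactly one ancestor on level \<open>n\<close> and is incomparable with the other
  vertices there. So \<open>q ^ (n + k)\<close> pairs contribute, each the \<open>k\<close>-th Fourier coefficient, and dividing by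
  \<open>q\<close> to the power \<open>n / 2 + (n + k) / 2\<close> leaves the factor \<open>sqrt q ^ k\<close>. The level sums are therefore stationary.
\<close>

lemma cov_normalized_level_sum:
  assumes q: "q > 0" and X: "branching_spectral_measure M (Tq_vertices q) (Tq_edges q) [] X \<nu>"
  shows "cov M (normalized_level_sum q X n) (normalized_level_sum q X (n + k)) = of_real (sqrt q ^ k) * (\<integral>z. cnj z ^ k \<partial>\<nu>)"
proof -
  let ?L = "\<lambda>n. {\<sigma> \<in> Tq_vertices q. length \<sigma> = n}"
  define c where "c = (\<integral>z. cnj z ^ k \<partial>\<nu>)"
  have X': "mean_zero_L2_process M (Tq_vertices q) X"
    and desc: "\<And>\<sigma> \<rho>. \<sigma> @ \<rho> \<in> Tq_vertices q \<Longrightarrow> cov M (X \<sigma>) (X (\<sigma> @ \<rho>)) = (\<integral>z. cnj z ^ length \<rho> \<partial>\<nu>)"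
    and incomp: "\<And>\<sigma> \<tau>. \<sigma> \<in> Tq_vertices q \<Longrightarrow> \<tau> \<in> Tq_vertices q \<Longrightarrow> \<not> prefix \<sigma> \<tau> \<Longrightarrow> \<not> prefix \<tau> \<sigma> \<Longrightarrow> cov M (X \<sigma>) (X \<tau>) = 0"
    using X unfolding branching_spectral_measure_iff[OF q] by blast+
  have inner: "(\<Sum>\<sigma>\<in>?L n. cov M (X \<sigma>) (X \<tau>)) = c" if \<tau>: "\<tau> \<in> ?L (n + k)" for \<tau>
  proof -
    have "take n \<tau> \<in> ?L n" using \<tau> by (auto simp: Tq_vertices_def dest: in_set_takeD)
    moreover have "cov M (X \<sigma>) (X \<tau>) = (if \<sigma> = take n \<tau> then c else 0)" if \<sigma>: "\<sigma> \<in> ?L n" for \<sigma>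
    proof (cases "\<sigma> = take n \<tau>")
      case True
      have "cov M (X (take n \<tau>)) (X (take n \<tau> @ drop n \<tau>)) = c"
        using \<tau> by (subst desc) (auto simp: c_def)
      with True show ?thesis by simp
    next
      case False
      have "\<not> prefix \<sigma> \<tau>"
      proof
        assume "prefix \<sigma> \<tau>"
        then obtain \<rho> where "\<tau> = \<sigma> @ \<rho>" by (rule prefixE)
        with False \<sigma> show False by simp
      qed
      moreover have "\<not> prefix \<tau> \<sigma>"
      proof
        assume "prefix \<tau> \<sigma>"
        then obtain \<rho> where \<rho>: "\<sigma> = \<tau> @ \<rho>" by (rule prefixE)
        moreover have "length \<rho> = 0" using arg_cong[OF \<rho>, of length] \<sigma> \<tau> by simp
        ultimately show False using \<open>\<not> prefix \<sigma> \<tau>\<close> by simp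
      qed
      ultimately show ?thesis using False incomp \<sigma> \<tau> by simp
    qed
    ultimately show ?thesis by (simp add: finite_Tq_level)
  qed
  have "cov M (normalized_level_sum q X n) (normalized_level_sum q X (n + k)) =
    (\<Sum>\<sigma>\<in>?L n. \<Sum>\<tau>\<in>?L (n + k). of_real (1 / sqrt q ^ n) * cnj (of_real (1 / sqrt q ^ (n + k))) * cov M (X \<sigma>) (X \<tau>))"
    unfolding normalized_level_sum_def[abs_def] using X' by (intro cov_sum_sum[where I = "Tq_vertices q"]) auto
  also have "\<dots> = (\<Sum>\<tau>\<in>?L (n + k). of_real (1 / sqrt q ^ n) * cnj (of_real (1 / sqrt q ^ (n + k))) * (\<Sum>\<sigma>\<in>?L n. cov M (X \<sigma>) (X \<tau>)))"
    by (subst sum.swap) (simp add: sum_distrib_left)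
  also have "\<dots> = (\<Sum>\<tau>\<in>?L (n + k). of_real (1 / sqrt q ^ n) * cnj (of_real (1 / sqrt q ^ (n + k))) * c)"
    by (intro sum.cong refl arg_cong2[where f = "(*)"] inner)
  also have "\<dots> = of_real (real q ^ (n + k) / (sqrt q ^ n * sqrt q ^ (n + k))) * c"
    by (simp add: card_Tq_level)
  also have "real q ^ (n + k) / (sqrt q ^ n * sqrt q ^ (n + k)) = sqrt q ^ k"
  proof -
    have "real q ^ (n + k) = sqrt q ^ (n + k) * sqrt q ^ (n + k)"
      by (simp add: power_mult_distrib[symmetric])
    then show ?thesis using q by (simp add: power_add)
  qed
  finally show ?thesis by (simp add: c_def)
qed

text \<open>
  The form is the second moment of a linear combination of the variables.
\<close>

lemma covariance_positive_definite:
  assumes X: "mean_zero_L2_process M I X" and A: "A \<subseteq> I"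
  shows "(\<Sum>i\<in>A. \<Sum>j\<in>A. u i * cnj (u j) * cov M (X i) (X j)) \<in> \<real>\<^sub>\<ge>\<^sub>0"
proof -
  define S where "S \<omega> = (\<Sum>i\<in>A. u i * X i \<omega>)" for \<omega>
  have "(\<Sum>i\<in>A. \<Sum>j\<in>A. u i * cnj (u j) * cov M (X i) (X j)) = cov M S S"
    unfolding S_def[abs_def] by (rule cov_sum_sum[OF X A A, symmetric])
  also have "\<dots> = (\<integral>\<omega>. complex_of_real ((cmod (S \<omega>))\<^sup>2) \<partial>M)"
    unfolding cov_def complex_norm_square ..
  also have "\<dots> = of_real (\<integral>\<omega>. (cmod (S \<omega>))\<^sup>2 \<partial>M)"
    by (rule integral_complex_of_real)
  finally show ?thesis by simp
qed

lemma mean_zero_L2_normalized_level_sum: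
  assumes X: "mean_zero_L2_process M (Tq_vertices q) X"
  shows "mean_zero_L2_process M UNIV (normalized_level_sum q X)"
proof -
  have X_meas: "X \<sigma> \<in> borel_measurable M" and X_sq: "integrable M (\<lambda>\<omega>. (cmod (X \<sigma> \<omega>))\<^sup>2)"
    and X_mean: "integral\<^sup>L M (X \<sigma>) = 0" if "\<sigma> \<in> Tq_vertices q" for \<sigma>
    using X that by (auto simp: mean_zero_L2_process_def)
  interpret prob_space M using X by (simp add: mean_zero_L2_process_def)
  have X_int: "integrable M (X \<sigma>)" if "\<sigma> \<in> Tq_vertices q" for \<sigma>
    using integrable_mult_cnj[OF X_meas[OF that] _ X_sq[OF that], of "\<lambda>_. 1"] by simp
  have meas: "normalized_level_sum q X n \<in> borel_measurable M" for n
    unfolding normalized_level_sum_def[abs_def] by (intro borel_measurable_sum borel_measurable_times X_meas) auto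
  have "integrable M (\<lambda>\<omega>. (cmod (normalized_level_sum q X n \<omega>))\<^sup>2)" for n
  proof -
    have "complex_of_real ((cmod (normalized_level_sum q X n \<omega>))\<^sup>2) =
      (\<Sum>\<sigma> | \<sigma> \<in> Tq_vertices q \<and> length \<sigma> = n. \<Sum>\<tau> | \<tau> \<in> Tq_vertices q \<and> length \<tau> = n.
        of_real (1 / sqrt q ^ n) * of_real (1 / sqrt q ^ n) * (X \<sigma> \<omega> * cnj (X \<tau> \<omega>)))" for \<omega>
      unfolding complex_norm_square normalized_level_sum_def cnj_sum sum_product
      by (intro sum.cong refl) (simp add: mult_ac)
    moreover have "integrable M (\<lambda>\<omega>. \<Sum>\<sigma> | \<sigma> \<in> Tq_vertices q \<and> length \<sigma> = n. \<Sum>\<tau> | \<tau> \<in> Tq_vertices q \<and> length \<tau> = n.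
        of_real (1 / sqrt q ^ n) * of_real (1 / sqrt q ^ n) * (X \<sigma> \<omega> * cnj (X \<tau> \<omega>)))"
      by (intro Bochner_Integration.integrable_sum integrable_mult_right integrable_mult_cnj X_meas X_sq) auto
    ultimately have "integrable M (\<lambda>\<omega>. complex_of_real ((cmod (normalized_level_sum q X n \<omega>))\<^sup>2))" by simp
    then show ?thesis by (simp only: complex_of_real_integrable_eq)
  qed
  moreover have "integral\<^sup>L M (normalized_level_sum q X n) = 0" for n
    unfolding normalized_level_sum_def[abs_def] using X_int X_mean
    by (subst Bochner_Integration.integral_sum) auto
  ultimately show ?thesis using meas prob_space_axioms by (auto simp: mean_zero_L2_process_def)
qed

text \<open>
  The covariances of the stationary sequence of normalised level sums are positive definite, so Herglotz
  provides a measure whose \<open>k\<close>-th coefficient is \<open>sqrt q ^ k\<close> times that of \<open>\<nu>\<close>. Convolution with the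
  Poisson kernel of radius \<open>1 / sqrt q\<close> removes this factor.
\<close>

theorem branching_spectral_measure_imp_poisson_conv:
  assumes q: "q \<ge> 2" and X: "branching_spectral_measure M (Tq_vertices q) (Tq_edges q) [] X \<nu>"
  shows "\<exists>\<mu>. radon_torus \<mu> \<and> \<nu> = poisson_conv_measure (1 / sqrt (real q)) \<mu>"
proof -
  have q0: "q > 0" using q by simp
  note X' = X[unfolded branching_spectral_measure_iff[OF q0]]
  define b where "b k = of_real (sqrt q ^ k) * (\<integral>z. cnj z ^ k \<partial>\<nu>)" for k
  define a where "a j = (if j \<ge> 0 then b (nat j) else cnj (b (nat (- j))))" for j
  have cov_a: "cov M (normalized_level_sum q X m) (normalized_level_sum q X n) = a (int n - int m)" for m n
  proof (cases "m \<le> n")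
    case True
    then show ?thesis using cov_normalized_level_sum[OF q0 X, of m "n - m"]
      by (simp add: a_def b_def nat_diff_distrib)
  next
    case False
    then show ?thesis using cov_normalized_level_sum[OF q0 X, of n "m - n"] cov_cnj[of M "normalized_level_sum q X m"]
      by (simp add: a_def b_def nat_diff_distrib)
  qed
  have "mean_zero_L2_process M UNIV (normalized_level_sum q X)"
    using X' by (intro mean_zero_L2_normalized_level_sum) auto
  then have "(\<Sum>m<N. \<Sum>n<N. u m * cnj (u n) * a (int n - int m)) \<in> \<real>\<^sub>\<ge>\<^sub>0" for N u
    using covariance_positive_definite[of M UNIV "normalized_level_sum q X" "{..<N}" u] by (simp add: cov_a)
  then obtain \<mu> where \<mu>: "radon_torus \<mu>" and \<mu>_hat: "\<And>k. (\<integral>z. cnj z ^ k \<partial>\<mu>) = a (int k)"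
    using Herglotz[of a] by auto
  have r: "0 \<le> 1 / sqrt q" "1 / sqrt q < 1" using q by auto
  have "\<nu> = poisson_conv_measure (1 / sqrt q) \<mu>"
  proof (rule radon_torus_eqI_Fourier)
    show "(\<integral>z. cnj z ^ k \<partial>\<nu>) = (\<integral>z. cnj z ^ k \<partial>poisson_conv_measure (1 / sqrt q) \<mu>)" for k
      using q by (simp add: Fourier_poisson_conv_measure[OF r \<mu>] \<mu>_hat a_def b_def power_one_over)
  qed (use X' radon_torus_poisson_conv_measure[OF r \<mu>] in auto)
  with \<mu> show ?thesis by blast
qed


section \<open>From a measure to a branching process\<close>

lemma (in pair_sigma_finite) integral_mult_fst_snd:
  fixes f :: "'a \<Rightarrow> complex" and g :: "'b \<Rightarrow> complex"
  assumes f: "integrable M1 f" and g: "integrable M2 g"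
  shows "integrable (M1 \<Otimes>\<^sub>M M2) (\<lambda>p. f (fst p) * g (snd p))"
    and "(\<integral>p. f (fst p) * g (snd p) \<partial>(M1 \<Otimes>\<^sub>M M2)) = integral\<^sup>L M1 f * integral\<^sup>L M2 g"
proof -
  note [measurable] = borel_measurable_integrable[OF f] borel_measurable_integrable[OF g]
  show int: "integrable (M1 \<Otimes>\<^sub>M M2) (\<lambda>p. f (fst p) * g (snd p))"
    using f g by (intro Fubini_integrable) (auto simp: norm_mult)
  show "(\<integral>p. f (fst p) * g (snd p) \<partial>(M1 \<Otimes>\<^sub>M M2)) = integral\<^sup>L M1 f * integral\<^sup>L M2 g"
    using integral_fst'[OF int] by simp
qed

text \<open>
  A process can be replaced by the coordinates on its path space. This realises a process built on
  any convenient probability space on the measurable space of functions on the index set.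
\<close>

lemma canonical_process:
  fixes X :: "'i \<Rightarrow> 'w \<Rightarrow> complex"
  assumes X: "mean_zero_L2_process M UNIV X"
  defines "M' \<equiv> distr M (Pi\<^sub>M UNIV (\<lambda>_. borel)) (\<lambda>\<omega> i. X i \<omega>)"
  shows "mean_zero_L2_process M' UNIV (\<lambda>i x. x i)"
    and "cov M' (\<lambda>x. x i) (\<lambda>x. x j) = cov M (X i) (X j)"
proof -
  have path: "(\<lambda>\<omega> i. X i \<omega>) \<in> M \<rightarrow>\<^sub>M Pi\<^sub>M UNIV (\<lambda>_. borel)"
    using X by (intro measurable_PiM_single') (auto simp: mean_zero_L2_process_def)
  have [measurable]: "(\<lambda>x. x i) \<in> Pi\<^sub>M UNIV (\<lambda>_. borel) \<rightarrow>\<^sub>M (borel :: complex measure)" for i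
    by (rule measurable_component_singleton) simp
  have [measurable]: "cnj \<in> borel_measurable borel"
    by (intro borel_measurable_continuous_onI continuous_intros)
  have "prob_space M'"
    using X path unfolding M'_def mean_zero_L2_process_def by (auto intro: prob_space.prob_space_distr)
  then show "mean_zero_L2_process M' UNIV (\<lambda>i x. x i)"
    using X path unfolding mean_zero_L2_process_def M'_def
    by (auto simp: integrable_distr_eq integral_distr)
  show "cov M' (\<lambda>x. x i) (\<lambda>x. x j) = cov M (X i) (X j)"
    unfolding cov_def M'_def by (subst integral_distr[OF path]) auto
qed

text \<open>
  For the zero measure any probability measure serves, since the factor in front is 0. So a random
  point can be drawn without assuming that \<open>\<mu>\<close> is nonzero.
\<close>

lemma radon_torus_normalize:
  assumes \<mu>: "radon_torus \<mu>"
  shows "\<exists>D. radon_torus D \<and> prob_space D \<and>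
    (\<forall>k. (\<integral>z. cnj z ^ k \<partial>\<mu>) = of_real (measure \<mu> (sphere 0 1)) * (\<integral>z. cnj z ^ k \<partial>D))"
proof (cases "measure \<mu> (sphere 0 1) = 0")
  case True
  interpret finite_measure \<mu> using \<mu> by (rule radon_torus_finite)
  have "emeasure \<mu> (space \<mu>) = 0"
    using True by (simp add: emeasure_eq_measure radon_torus_space[OF \<mu>])
  then have "AE z in \<mu>. False" by (intro AE_I[where N = "space \<mu>"]) auto
  then have "(\<integral>z. cnj z ^ k \<partial>\<mu>) = 0" for k by (intro integral_eq_zero_AE) auto
  moreover have "prob_space (return torus 1)" by (rule prob_space_return) simp
  moreover then have "radon_torus (return torus 1)" by (simp add: radon_torus_def prob_space_def)
  ultimately show ?thesis using True by auto
next
  case False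
  define m where "m = measure \<mu> (sphere 0 1)"
  have m: "m > 0" using False by (simp add: m_def less_le)
  define D where "D = density \<mu> (\<lambda>_. ennreal (1 / m))"
  have D: "radon_torus D" and "measure D (sphere 0 1) = 1"
    using radon_torus_density[OF \<mu>, of "\<lambda>_. 1 / m"] m
      finite_measure.integrable_const[OF radon_torus_finite[OF \<mu>]]
    by (auto simp: D_def radon_torus_space[OF \<mu>] m_def)
  then have "prob_space D"
    using finite_measure.emeasure_eq_measure[OF radon_torus_finite[OF D]]
    by (intro prob_spaceI) (simp add: radon_torus_space[OF D])
  moreover have "(\<integral>z. cnj z ^ k \<partial>\<mu>) = of_real m * (\<integral>z. cnj z ^ k \<partial>D)" for k
  proof -
    have "(\<integral>z. cnj z ^ k \<partial>D) = (\<integral>z. (1 / m) *\<^sub>R cnj z ^ k \<partial>\<mu>)"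
      unfolding D_def using m
      by (intro integral_density continuous_measurable_torus continuous_intros radon_torus_sets \<mu>) auto
    then show ?thesis using m by (simp add: scaleR_conv_of_real)
  qed
  ultimately show ?thesis using D by (auto simp: m_def)
qed

text \<open>
  The law of a random end of the tree, chosen by independent uniform letters.
\<close>

definition boundary_measure :: "nat \<Rightarrow> (nat \<Rightarrow> nat) measure" where
  "boundary_measure q = Pi\<^sub>M UNIV (\<lambda>_. measure_pmf (pmf_of_set {..<q}))"

definition cylinder :: "nat list \<Rightarrow> (nat \<Rightarrow> nat) set" where
  "cylinder \<sigma> = {\<xi>. \<forall>i<length \<sigma>. \<xi> i = \<sigma> ! i}"

lemma prob_space_boundary_measure: "prob_space (boundary_measure q)"
  unfolding boundary_measure_def by (intro prob_space_PiM measure_pmf.prob_space_axioms)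

lemma
  shows cylinder_in_sets: "cylinder \<sigma> \<in> sets (boundary_measure q)"
    and measure_cylinder: "\<sigma> \<in> Tq_vertices q \<Longrightarrow> measure (boundary_measure q) (cylinder \<sigma>) = 1 / real q ^ length \<sigma>"
proof -
  interpret product_prob_space "\<lambda>_::nat. measure_pmf (pmf_of_set {..<q})" UNIV
    by unfold_locales
  have emb: "cylinder \<sigma> = prod_emb UNIV (\<lambda>_. measure_pmf (pmf_of_set {..<q})) {..<length \<sigma>} (\<Pi>\<^sub>E i\<in>{..<length \<sigma>}. {\<sigma> ! i})"
    by (subst prod_emb_PiE) (auto simp: cylinder_def PiE_iff Ball_def split: if_split_asm)
  show "cylinder \<sigma> \<in> sets (boundary_measure q)"
    unfolding emb boundary_measure_def by (intro sets_PiM_I) auto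
  assume \<sigma>: "\<sigma> \<in> Tq_vertices q"
  have "measure (boundary_measure q) (cylinder \<sigma>) = (\<Prod>i<length \<sigma>. measure (measure_pmf (pmf_of_set {..<q})) {\<sigma> ! i})"
    unfolding emb boundary_measure_def by (intro measure_PiM_emb) auto
  also have "\<dots> = (\<Prod>i<length \<sigma>. 1 / real q)"
  proof (intro prod.cong refl)
    fix i assume "i \<in> {..<length \<sigma>}"
    then have "\<sigma> ! i < q"
      using \<sigma> nth_mem[of i \<sigma>] by (auto simp: Tq_vertices_def in_lists_conv_set)
    then show "measure (measure_pmf (pmf_of_set {..<q})) {\<sigma> ! i} = 1 / real q"
      by (simp add: measure_pmf_single pmf_of_set lessThan_empty_iff indicator_def)
  qed
  finally show "measure (boundary_measure q) (cylinder \<sigma>) = 1 / real q ^ length \<sigma>"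
    by (simp add: power_one_over)
qed

lemma cylinder_append_subset: "cylinder (\<sigma> @ \<rho>) \<subseteq> cylinder \<sigma>"
  by (auto simp: cylinder_def nth_append)

lemma cylinder_disjoint:
  assumes "\<not> prefix \<sigma> \<tau>" "\<not> prefix \<tau> \<sigma>"
  shows "cylinder \<sigma> \<inter> cylinder \<tau> = {}"
proof -
  have "prefix \<sigma> \<tau>" if le: "length \<sigma> \<le> length \<tau>" and \<xi>: "\<xi> \<in> cylinder \<sigma>" "\<xi> \<in> cylinder \<tau>" for \<sigma> \<tau> \<xi>
  proof -
    have "take (length \<sigma>) \<tau> = \<sigma>"
      using le \<xi> by (intro nth_equalityI) (auto simp: cylinder_def)
    then show ?thesis using take_is_prefix by metis
  qed
  then show ?thesis using assms by (metis IntE equals0I linorder_le_cases)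
qed

text \<open>
  Let \<open>z\<close> be a random point with law proportional to \<open>\<mu>\<close>, let \<open>\<xi>\<close> be an independent uniform end and let
  \<open>\<epsilon>\<close> be an independent fair sign. The process is
  \<open>\<epsilon> * m * z ^ n * sqrt q ^ n * indicator (cylinder \<sigma>) \<xi>\<close> with \<open>n = length \<sigma>\<close>, where \<open>m\<close> is the square root of
  the mass of \<open>\<mu>\<close>. The powers of \<open>z\<close> contribute the Fourier coefficients of \<open>\<mu>\<close>. The normalised indicators
  have inner product \<open>sqrt q ^ (n + n + k) / q ^ (n + k)\<close>, that is \<open>1 / sqrt q ^ k\<close>, for a descendant at
  distance \<open>k\<close>, and 0 for incomparable vertices, whose cylinders are disjoint. The sign leaves
  covariances unchanged and makes the means vanish.
\<close>

theorem poisson_conv_imp_branching_spectral_measure: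
  assumes q: "q \<ge> 2" and \<mu>: "radon_torus \<mu>"
  shows "\<exists>(M :: (nat list \<Rightarrow> complex) measure) X. branching_spectral_measure M
    (Tq_vertices q) (Tq_edges q) [] X (poisson_conv_measure (1 / sqrt q) \<mu>)"
proof -
  obtain D where D: "radon_torus D" and "prob_space D"
    and D_hat: "\<And>k. (\<integral>z. cnj z ^ k \<partial>\<mu>) = of_real (measure \<mu> (sphere 0 1)) * (\<integral>z. cnj z ^ k \<partial>D)"
    using radon_torus_normalize[OF \<mu>] by blast
  define W where "W = boundary_measure q"
  define S where "S = measure_pmf (bernoulli_pmf (1 / 2))"
  interpret D: prob_space D by fact
  interpret W: prob_space W unfolding W_def by (rule prob_space_boundary_measure)
  interpret S: prob_space S unfolding S_def by (rule measure_pmf.prob_space_axioms)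
  interpret DW: pair_prob_space D W ..
  interpret SDW: pair_prob_space S "D \<Otimes>\<^sub>M W" ..
  define m where "m = sqrt (measure \<mu> (sphere 0 1))"
  define \<epsilon> where "\<epsilon> b = (if b then 1 else - 1 :: complex)" for b
  define f where "f \<sigma> z = of_real (m * sqrt q ^ length \<sigma>) * z ^ length \<sigma>" for \<sigma> :: "nat list" and z :: complex
  define g where "g \<sigma> \<xi> = (indicator (cylinder \<sigma>) \<xi> :: complex)" for \<sigma> \<xi>
  define X where "X \<sigma> p = \<epsilon> (fst p) * (f \<sigma> (fst (snd p)) * g \<sigma> (snd (snd p)))" for \<sigma> p
  define P where "P = S \<Otimes>\<^sub>M (D \<Otimes>\<^sub>M W)"
  have \<epsilon>_int: "integrable S h" "integral\<^sup>L S h = (h True + h False) / 2" for h :: "bool \<Rightarrow> complex"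
  proof -
    show "integrable S h"
      unfolding S_def by (intro integrable_measure_pmf_finite) simp
    show "integral\<^sup>L S h = (h True + h False) / 2"
      unfolding S_def by (subst integral_measure_pmf[of UNIV]) (auto simp: UNIV_bool scaleR_conv_of_real field_simps)
  qed
  have f_int: "integrable D (f \<sigma>)" "integrable D (\<lambda>z. f \<sigma> z * cnj (f \<tau> z))" for \<sigma> \<tau>
    unfolding f_def by (intro continuous_integrable_torus D continuous_intros)+
  have [measurable]: "cylinder \<sigma> \<in> sets W" for \<sigma> unfolding W_def by (rule cylinder_in_sets)
  have g_int: "integrable W (g \<sigma>)" for \<sigma>
    unfolding g_def by (intro W.integrable_const_bound[where B = 1]) (auto split: split_indicator)
  have gg: "g \<sigma> \<xi> * cnj (g \<tau> \<xi>) = of_real (indicator (cylinder \<sigma> \<inter> cylinder \<tau>) \<xi>)" for \<sigma> \<tau> \<xi>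
    by (simp add: g_def split: split_indicator)
  have gg_int: "integrable W (\<lambda>\<xi>. g \<sigma> \<xi> * cnj (g \<tau> \<xi>))" for \<sigma> \<tau>
    unfolding gg by (intro W.integrable_const_bound[where B = 1]) (auto split: split_indicator)
  have X_cnj: "X \<sigma> p * cnj (X \<tau> p) = 1 * ((\<lambda>q. (f \<sigma> (fst q) * cnj (f \<tau> (fst q))) * (g \<sigma> (snd q) * cnj (g \<tau> (snd q)))) (snd p))" for \<sigma> \<tau> p
    by (simp add: X_def \<epsilon>_def)
  have XX_int: "integrable P (\<lambda>p. X \<sigma> p * cnj (X \<tau> p))"
    and XX: "cov P (X \<sigma>) (X \<tau>) = (\<integral>z. f \<sigma> z * cnj (f \<tau> z) \<partial>D) * measure W (cylinder \<sigma> \<inter> cylinder \<tau>)" for \<sigma> \<tau>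
  proof -
    note DW = DW.integral_mult_fst_snd[OF f_int(2)[of \<sigma> \<tau>] gg_int[of \<sigma> \<tau>]]
    note SDW = SDW.integral_mult_fst_snd[OF \<epsilon>_int(1)[of "\<lambda>_. 1"] DW(1)]
    show "integrable P (\<lambda>p. X \<sigma> p * cnj (X \<tau> p))"
      unfolding P_def X_cnj using SDW(1) by simp
    have "cov P (X \<sigma>) (X \<tau>) = (\<integral>z. f \<sigma> z * cnj (f \<tau> z) \<partial>D) * (\<integral>\<xi>. g \<sigma> \<xi> * cnj (g \<tau> \<xi>) \<partial>W)"
      unfolding cov_def P_def X_cnj using SDW(2) DW(2) by (simp add: S.prob_space)
    also have "(\<integral>\<xi>. g \<sigma> \<xi> * cnj (g \<tau> \<xi>) \<partial>W) = measure W (cylinder \<sigma> \<inter> cylinder \<tau>)"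
      unfolding gg by (simp add: W_def boundary_measure_def space_PiM)
    finally show "cov P (X \<sigma>) (X \<tau>) = (\<integral>z. f \<sigma> z * cnj (f \<tau> z) \<partial>D) * measure W (cylinder \<sigma> \<inter> cylinder \<tau>)" .
  qed
  have "mean_zero_L2_process P UNIV X"
    unfolding mean_zero_L2_process_def
  proof (intro conjI ballI)
    show "prob_space P" unfolding P_def by (rule SDW.prob_space_axioms)
    fix \<sigma>
    note SDW = SDW.integral_mult_fst_snd[OF \<epsilon>_int(1)[of \<epsilon>] DW.integral_mult_fst_snd(1)[OF f_int(1)[of \<sigma>] g_int[of \<sigma>]]]
    show "X \<sigma> \<in> borel_measurable P" "integral\<^sup>L P (X \<sigma>) = 0"
      using borel_measurable_integrable[OF SDW(1)] SDW(2)
      by (simp_all add: X_def[abs_def] P_def \<epsilon>_int(2)[of \<epsilon>]) (simp_all add: \<epsilon>_def)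
    show "integrable P (\<lambda>p. (cmod (X \<sigma> p))\<^sup>2)"
      using XX_int[of \<sigma> \<sigma>] unfolding complex_norm_square[symmetric] by (simp only: complex_of_real_integrable_eq)
  qed
  note canonical = canonical_process[OF this]
  define r where "r = 1 / sqrt q"
  have r: "0 \<le> r" "r < 1" using q by (auto simp: r_def)
  have cov_desc: "cov P (X \<sigma>) (X (\<sigma> @ \<rho>)) = (\<integral>z. cnj z ^ length \<rho> \<partial>poisson_conv_measure r \<mu>)"
    if V: "\<sigma> @ \<rho> \<in> Tq_vertices q" for \<sigma> \<rho>
  proof -
    let ?n = "length \<sigma>" and ?k = "length \<rho>"
    have "(\<integral>z. f \<sigma> z * cnj (f (\<sigma> @ \<rho>) z) \<partial>D) =
      (\<integral>z. of_real (m\<^sup>2 * sqrt q ^ (?n + (?n + ?k))) * (z ^ ?n * cnj z ^ (?n + ?k)) \<partial>D)"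
      unfolding f_def by (intro Bochner_Integration.integral_cong) (auto simp: power_add power2_eq_square mult_ac)
    also have "\<dots> = of_real (m\<^sup>2 * sqrt q ^ (?n + (?n + ?k))) * (\<integral>z. cnj z ^ ?k \<partial>D)"
      by (simp add: integral_cnj_torus[OF D])
    finally have fD: "(\<integral>z. f \<sigma> z * cnj (f (\<sigma> @ \<rho>) z) \<partial>D) = \<dots>" .
    have "cylinder \<sigma> \<inter> cylinder (\<sigma> @ \<rho>) = cylinder (\<sigma> @ \<rho>)" using cylinder_append_subset by blast
    then have "cov P (X \<sigma>) (X (\<sigma> @ \<rho>)) =
      of_real (m\<^sup>2 * sqrt q ^ (?n + (?n + ?k))) * (\<integral>z. cnj z ^ ?k \<partial>D) * of_real (1 / real q ^ (?n + ?k))"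
      unfolding XX fD using measure_cylinder[OF V] by (simp add: W_def)
    also have "\<dots> = of_real (sqrt q ^ (?n + (?n + ?k)) / real q ^ (?n + ?k)) * (of_real (m\<^sup>2) * (\<integral>z. cnj z ^ ?k \<partial>D))"
      by simp
    also have "sqrt q ^ (?n + (?n + ?k)) / real q ^ (?n + ?k) = r ^ ?k"
    proof -
      have "real q ^ (?n + ?k) = sqrt q ^ (?n + ?k) * sqrt q ^ (?n + ?k)"
        by (simp add: power_mult_distrib[symmetric])
      then show ?thesis using q by (simp add: r_def power_add power_one_over divide_simps)
    qed
    also have "of_real (m\<^sup>2) * (\<integral>z. cnj z ^ ?k \<partial>D) = (\<integral>z. cnj z ^ ?k \<partial>\<mu>)"
      by (simp add: m_def D_hat)
    finally show ?thesis by (simp only: Fourier_poisson_conv_measure[OF r \<mu>])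
  qed
  have "branching_spectral_measure (distr P (Pi\<^sub>M UNIV (\<lambda>_. borel)) (\<lambda>p \<sigma>. X \<sigma> p))
    (Tq_vertices q) (Tq_edges q) [] (\<lambda>\<sigma> x. x \<sigma>) (poisson_conv_measure r \<mu>)"
    using q canonical(1) cov_desc
    by (subst branching_spectral_measure_iff)
      (auto simp: canonical(2) radon_torus_poisson_conv_measure[OF r \<mu>] XX cylinder_disjoint mean_zero_L2_process_def)
  then show ?thesis unfolding r_def by blast
qed

theorem theorem1p2:
  fixes q :: nat and \<nu> :: "complex measure"
  assumes "q \<ge> 2"
  shows "((\<exists>(M :: (nat list \<Rightarrow> complex) measure) X.
             branching_spectral_measure M (Tq_vertices q) (Tq_edges q) [] X \<nu>)
          \<longleftrightarrow> (\<exists>\<mu>. radon_torus \<mu> \<and> \<nu> = poisson_conv_measure (1 / sqrt (real q)) \<mu>))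
       \<and> ((\<exists>(M :: 'w measure) X.
             branching_spectral_measure M (Tq_vertices q) (Tq_edges q) [] X \<nu>)
          \<longrightarrow> (\<exists>\<mu>. radon_torus \<mu> \<and> \<nu> = poisson_conv_measure (1 / sqrt (real q)) \<mu>))"
proof (intro conjI iffI impI)
  show "\<exists>\<mu>. radon_torus \<mu> \<and> \<nu> = poisson_conv_measure (1 / sqrt (real q)) \<mu>"
    if "\<exists>(M :: (nat list \<Rightarrow> complex) measure) X. branching_spectral_measure M (Tq_vertices q) (Tq_edges q) [] X \<nu>"
    using that branching_spectral_measure_imp_poisson_conv[OF assms] by blast
  show "\<exists>\<mu>. radon_torus \<mu> \<and> \<nu> = poisson_conv_measure (1 / sqrt (real q)) \<mu>"
    if "\<exists>(M :: 'w measure) X. branching_spectral_measure M (Tq_vertices q) (Tq_edges q) [] X \<nu>"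
    using that branching_spectral_measure_imp_poisson_conv[OF assms] by blast
  show "\<exists>(M :: (nat list \<Rightarrow> complex) measure) X. branching_spectral_measure M (Tq_vertices q) (Tq_edges q) [] X \<nu>"
    if "\<exists>\<mu>. radon_torus \<mu> \<and> \<nu> = poisson_conv_measure (1 / sqrt (real q)) \<mu>"
    using that poisson_conv_imp_branching_spectral_measure[OF assms] by blast
qed

end
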